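(* Let $\ell>2$ be a prime and $d\ge1$. Let $(V,Q)$ be the reduction mod $\ell$ of the lattice $U^{\oplus(2d-2)}\oplus(-E_8)^{\oplus d}$ (a nondegenerate quadratic space of dimension $12d-4$ over $\mathbb{F}_\ell$). Let $\Omega,A,B,C$ be the four cosets of $\Omega(Q)$ in $\mathrm{O}(Q)$: $\Omega=\Omega(Q)$; $A$ = trivial Dickson invariant, nontrivial spinor norm; $B$ = nontrivial Dickson invariant, trivial spinor norm; $C$ = both nontrivial. For a coset $H$ let $G_H(t)=\frac{1}{\#H}\sum_{g\in H}t^{\dim\ker(g-1)}$. Then $G_B=G_C$ and \[G_\Omega(t)=G_A(t)+\frac{1}{\#\Omega(Q)}\prod_{i=0}^{6d-3}(t^2-\ell^{2i}).\]
   Context: Here $U$ is the hyperbolic plane and $-E_8$ is the $E_8$ lattice with negated form. For $g\in\mathrm{O}(Q)$ over $\mathbb{F}_\ell$, $\ell$ odd: the Dickson invariant is $(1-\det g)/2\in\mathbb{Z}/2$; the ($-1$-)spinor norm is the homomorphism $\mathrm{O}(Q)\to\mathbb{F}_\ell^\times/(\mathbb{F}_\ell^\times)^2$ with $\mathrm{sp}(r_v)=[-Q(v)]$ for reflections $r_v(w)=w-\frac{B(w,v)}{Q(v)}v$, $Q(v)\ne0$, where $B(x,y)=Q(x+y)-Q(x)-Q(y)$. $\Omega(Q)$ is the intersection of the kernels of the Dickson invariant and spinor norm. *)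

theory Defs
  imports
    "HOL-Computational_Algebra.Primes"
    "HOL-Library.Cardinality"
    "HOL-Library.Z2"
    "HOL-Algebra.Coset"
    "Jordan_Normal_Form.Determinant"
    "Jordan_Normal_Form.Matrix_Kernel"
begin

text \<open>Lattices are given by the integral Gram matrix of their bilinear form in a fixed basis.\<close>

definition hyperbolic_gram :: "int mat" where
  "hyperbolic_gram = mat_of_rows_list 2 [[0, 1], [1, 0]]"

text \<open>The Cartan matrix of $E_8$, simple roots in Bourbaki's order
  (chain 1-3-4-5-6-7-8, with 2 attached to 4).\<close>

definition E8_gram :: "int mat" where
  "E8_gram = mat_of_rows_list 8
    [[ 2,  0, -1,  0,  0,  0,  0,  0],
     [ 0,  2,  0, -1,  0,  0,  0,  0],
     [-1,  0,  2, -1,  0,  0,  0,  0],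
     [ 0, -1, -1,  2, -1,  0,  0,  0],
     [ 0,  0,  0, -1,  2, -1,  0,  0],
     [ 0,  0,  0,  0, -1,  2, -1,  0],
     [ 0,  0,  0,  0,  0, -1,  2, -1],
     [ 0,  0,  0,  0,  0,  0, -1,  2]]"

definition UE8_gram :: "nat \<Rightarrow> int mat" where
  "UE8_gram d =
    diag_block_mat (replicate (2 * d - 2) hyperbolic_gram @ replicate d (- E8_gram))"

text \<open>The quadratic form of an even lattice with Gram matrix \<open>M\<close> is
  $x \mapsto \frac{1}{2} x^T M x$, so that its polar form is the bilinear form of the lattice. The
  following is its reduction over a field in which 2 is invertible.\<close>

definition reduced_form :: "int mat \<Rightarrow> 'a::field vec \<Rightarrow> 'a" where
  "reduced_form M v = (v \<bullet> (map_mat of_int M *\<^sub>v v)) / 2"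

definition polar :: "('a::field vec \<Rightarrow> 'a) \<Rightarrow> 'a vec \<Rightarrow> 'a vec \<Rightarrow> 'a" where
  "polar Q x y = Q (x + y) - Q x - Q y"

definition reflection :: "('a::field vec \<Rightarrow> 'a) \<Rightarrow> 'a vec \<Rightarrow> 'a vec \<Rightarrow> 'a vec" where
  "reflection Q v w = w - (polar Q w v / Q v) \<cdot>\<^sub>v v"

definition orthogonal_group :: "nat \<Rightarrow> ('a::field vec \<Rightarrow> 'a) \<Rightarrow> 'a mat monoid" where
  "orthogonal_group n Q =
    \<lparr>carrier = {g \<in> carrier_mat n n. invertible_mat g \<and>
                  (\<forall>v \<in> carrier_vec n. Q (g *\<^sub>v v) = Q v)},
     mult = (*), one = 1\<^sub>m n\<rparr>"

text \<open>On an orthogonal group in odd characteristic $\det g = \pm 1$, so $(1 - \det g)/2$ is the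
  field element 0 or 1; it is read in $\mathbb{Z}/2$.\<close>

definition dickson :: "'a::field mat \<Rightarrow> bit" where
  "dickson g = (if (1 - det g) / 2 = 0 then 0 else 1)"

definition unit_group :: "'a::field monoid" where
  "unit_group = units_of class_ring"

definition unit_squares :: "'a::field set" where
  "unit_squares = {x * x | x. x \<in> carrier unit_group}"

definition square_classes :: "'a::field set monoid" where
  "square_classes = unit_group Mod unit_squares"

definition square_class :: "'a::field \<Rightarrow> 'a set" where
  "square_class a = unit_squares #>\<^bsub>unit_group\<^esub> a"

text \<open>Orthogonal groups of nondegenerate forms in odd characteristic are generated by reflections,
  hence the values on the orthogonal group do not depend on the choice.\<close>

definition spinor_norm :: "nat \<Rightarrow> ('a::field vec \<Rightarrow> 'a) \<Rightarrow> 'a mat \<Rightarrow> 'a set" where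
  "spinor_norm n Q = (SOME sp. sp \<in> hom (orthogonal_group n Q) square_classes \<and>
    (\<forall>v \<in> carrier_vec n. Q v \<noteq> 0 \<longrightarrow>
      (\<forall>r \<in> carrier (orthogonal_group n Q).
        (\<forall>w \<in> carrier_vec n. r *\<^sub>v w = reflection Q v w) \<longrightarrow> sp r = square_class (- Q v))))"

definition coset_Omega :: "nat \<Rightarrow> ('a::field vec \<Rightarrow> 'a) \<Rightarrow> 'a mat set" where
  "coset_Omega n Q = {g \<in> carrier (orthogonal_group n Q).
    dickson g = 0 \<and> spinor_norm n Q g = \<one>\<^bsub>square_classes\<^esub>}"

definition coset_A :: "nat \<Rightarrow> ('a::field vec \<Rightarrow> 'a) \<Rightarrow> 'a mat set" where
  "coset_A n Q = {g \<in> carrier (orthogonal_group n Q).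
    dickson g = 0 \<and> spinor_norm n Q g \<noteq> \<one>\<^bsub>square_classes\<^esub>}"

definition coset_B :: "nat \<Rightarrow> ('a::field vec \<Rightarrow> 'a) \<Rightarrow> 'a mat set" where
  "coset_B n Q = {g \<in> carrier (orthogonal_group n Q).
    dickson g \<noteq> 0 \<and> spinor_norm n Q g = \<one>\<^bsub>square_classes\<^esub>}"

definition coset_C :: "nat \<Rightarrow> ('a::field vec \<Rightarrow> 'a) \<Rightarrow> 'a mat set" where
  "coset_C n Q = {g \<in> carrier (orthogonal_group n Q).
    dickson g \<noteq> 0 \<and> spinor_norm n Q g \<noteq> \<one>\<^bsub>square_classes\<^esub>}"

definition fix_gen_poly :: "nat \<Rightarrow> 'a::field mat set \<Rightarrow> rat poly" where
  "fix_gen_poly n H =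
    Polynomial.smult (1 / of_nat (card H)) (\<Sum>g\<in>H. Polynomial.monom 1 (kernel_dim (g - 1\<^sub>m n)))"

lemma UE8_gram_carrier:
  assumes "d \<ge> 1"
  shows "UE8_gram d \<in> carrier_mat (12 * d - 4) (12 * d - 4)"
  using assms
  by (auto simp: UE8_gram_def dim_diag_block_mat hyperbolic_gram_def E8_gram_def
      mat_of_rows_list_def sum_list_replicate intro!: carrier_matI)

lemma reduced_form_of_int:
  fixes x :: "int vec"
  assumes "M \<in> carrier_mat n n" "x \<in> carrier_vec n" "(2 :: 'a::field) \<noteq> 0"
  shows "2 * reduced_form M (map_vec of_int x :: 'a vec) = of_int (x \<bullet> (M *\<^sub>v x))"
proof -
  interpret H: comm_ring_hom "of_int :: int \<Rightarrow> 'a"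
    by unfold_locales auto
  have "(map_vec of_int x :: 'a vec) \<bullet> (map_mat of_int M *\<^sub>v map_vec of_int x)
      = of_int (x \<bullet> (M *\<^sub>v x))"
    using assms(1,2) by (auto simp: scalar_prod_def mult_mat_vec_def)
  then show ?thesis
    using assms(3) by (simp add: reduced_form_def)
qed

end

theory Submission
  imports Defs
begin

text \<open>
  Write \<open>q\<close> for the order of the field, \<open>n = 2 m\<close> for the dimension and \<open>\<chi>\<close> for the spinor norm,
  read as a sign. Then \<open>q\<close> to the power \<open>dim ker (g - 1)\<close> is the number of vectors fixed by \<open>g\<close>, so
  the value at \<open>t = q ^ j\<close> of the sum of \<open>\<chi> g * t ^ dim ker (g - 1)\<close> over a coset of
  $\mathrm{SO}$ is the sum of \<open>\<chi> g\<close> over all pairs of such a \<open>g\<close> and a \<open>j\<close>-tuple of vectors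
  that it fixes. If \<open>j < m\<close>, the orthogonal complement of the tuple takes all values of \<open>Q\<close>, so the
  pointwise stabilizer contains a product of two reflections with nontrivial spinor norm, and the
  sum vanishes. By Wall's argument \<open>det g\<close> determines the parity of \<open>dim ker (g - 1)\<close>, so both
  polynomials also vanish at the points \<open>- (q ^ j)\<close>. These are \<open>n\<close> roots; the polynomial of
  $\mathrm{SO}$ is monic of degree \<open>n\<close> and the one of the other coset has degree less than \<open>n\<close>.

  The spinor norm exists because it is the sign of the permutation that \<open>g\<close> induces on the
  vectors with \<open>Q x = a\<close>, where \<open>- a\<close> is a nonsquare.
\<close>

section \<open>Squares in finite fields\<close>

text \<open>If \<open>2 = 0\<close>, translation by 1 is an involution without fixed points and
  pairs up the elements of the field.\<close>

lemma two_neq_zero_if_odd_CARD: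
  assumes "odd CARD('k::{field,finite})"
  shows "(2 :: 'k) \<noteq> 0"
proof
  assume "(2 :: 'k) = 0"
  then have two: "(1 :: 'k) + 1 = 0" by simp
  have "\<exists>h :: 'k \<Rightarrow> 'k. \<forall>x. h x \<noteq> x \<and> h (h x) = x"
  proof (intro exI allI conjI)
    fix x :: 'k
    show "x + 1 \<noteq> x" by simp
    show "(x + 1) + 1 = x" using two by (simp add: add.assoc)
  qed
  then obtain h :: "'k \<Rightarrow> 'k" where h: "\<And>x. h x \<noteq> x" "\<And>x. h (h x) = x" by auto
  have "even (card (\<Union>x. {x, h x}))"
  proof -
    have "card (\<Union>(range (\<lambda>x. {x, h x}))) = sum card (range (\<lambda>x. {x, h x}))"
      by (rule card_Union_disjoint) (auto simp: pairwise_def disjnt_def h, (metis h(2))+)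
    also have "even \<dots>"
    proof (rule dvd_sum)
      fix a assume "a \<in> range (\<lambda>x. {x, h x})"
      then obtain x where "a = {x, h x}" by auto
      then show "even (card a)" using h(1)[of x] by (metis card_2_iff dvd_refl)
    qed
    finally show ?thesis .
  qed
  moreover have "(\<Union>x. {x, h x}) = UNIV" by auto
  ultimately show False using assms by simp
qed

lemma carrier_unit_group: "carrier (unit_group :: 'k::field monoid) = - {0}"
  by (auto simp: unit_group_def units_of_def Units_def class_ring_simps)
     (metis left_inverse right_inverse)

lemma unit_squares_iff: "(a :: 'k::field) \<in> unit_squares \<longleftrightarrow> (\<exists>x. x \<noteq> 0 \<and> a = x * x)"
  by (auto simp: unit_squares_def carrier_unit_group)

text \<open>Squaring is at most two-to-one, so at least half of the nonzero elements are
  squares.\<close>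

lemma card_unit_squares: "CARD('k::{field,finite}) \<le> 2 * card (unit_squares :: 'k set) + 1"
proof -
  have "- {0 :: 'k} \<subseteq> (\<Union>s\<in>unit_squares. {x. x * x = s})"
    by (auto simp: unit_squares_iff)
  then have "card (- {0 :: 'k}) \<le> card (\<Union>s\<in>(unit_squares :: 'k set). {x. x * x = s})"
    by (rule card_mono[rotated]) simp
  also have "\<dots> \<le> (\<Sum>s\<in>(unit_squares :: 'k set). card {x. x * x = s})"
    by (rule card_UN_le) simp
  also have "\<dots> \<le> (\<Sum>s\<in>(unit_squares :: 'k set). 2)"
  proof (rule sum_mono)
    fix s :: 'k assume "s \<in> unit_squares"
    then obtain y where "s = y * y" by (auto simp: unit_squares_iff)
    then have "{x. x * x = s} = {y, -y}" by (auto simp: square_eq_iff)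
    then show "card {x. x * x = s} \<le> 2" by (simp add: card_insert_if)
  qed
  also have "\<dots> = 2 * card (unit_squares :: 'k set)" by simp
  finally show ?thesis by (simp add: Compl_eq_Diff_UNIV)
qed

text \<open>If every element were a square, squaring would be injective by finiteness, although 1
  and -1 have the same square.\<close>

lemma nonsquare_exists:
  assumes "(2 :: 'k::{field,finite}) \<noteq> 0"
  shows "\<exists>a :: 'k. a \<noteq> 0 \<and> a \<notin> unit_squares"
proof (rule ccontr)
  assume "\<not> ?thesis"
  then have "\<And>a :: 'k. \<exists>x. a = x * x"
    by (metis unit_squares_iff mult_zero_left)
  then have "surj (\<lambda>x :: 'k. x * x)" by (auto simp: surj_def)
  then have "inj (\<lambda>x :: 'k. x * x)" by (simp add: finite_UNIV_surj_inj)
  then have "(1 :: 'k) = - 1" by (rule injD) simp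
  then have "(1 :: 'k) + 1 = 0" by (simp add: eq_neg_iff_add_eq_0)
  then show False using assms by simp
qed

lemma unit_squares_mult: "a \<in> unit_squares \<Longrightarrow> b \<in> unit_squares \<Longrightarrow> (a * b :: 'k::field) \<in> unit_squares"
  by (fastforce simp: unit_squares_iff intro: exI[of _ "_ * _"])

lemma unit_squares_inverse: "a \<in> unit_squares \<Longrightarrow> inverse (a :: 'k::field) \<in> unit_squares"
  by (fastforce simp: unit_squares_iff intro: exI[of _ "inverse _"])

lemma unit_squares_mult_cancel:
  "a \<in> unit_squares \<Longrightarrow> (a * b :: 'k::field) \<in> unit_squares \<longleftrightarrow> b \<in> unit_squares"
proof
  assume a: "a \<in> unit_squares" "a * b \<in> unit_squares"
  then have "inverse a * (a * b) \<in> unit_squares"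
    by (metis unit_squares_mult unit_squares_inverse)
  moreover have "a \<noteq> 0" using a(1) by (auto simp: unit_squares_iff)
  then have "inverse a * (a * b) = b" by (simp add: mult.assoc[symmetric])
  ultimately show "b \<in> unit_squares" by simp
qed (rule unit_squares_mult)

text \<open>Were \<open>a * b\<close> a nonsquare, the squares and their \<open>a\<close>-multiples
  would be disjoint sets that both avoid \<open>0\<close> and \<open>a * b\<close>. By
  \<open>card_unit_squares\<close> there is not enough room for them.\<close>

lemma nonsquare_mult:
  fixes a b :: "'k::{field,finite}"
  assumes "a \<noteq> 0" "b \<noteq> 0" "a \<notin> unit_squares" "b \<notin> unit_squares"
  shows "a * b \<in> unit_squares"
proof (rule ccontr)
  assume ab: "a * b \<notin> unit_squares"
  let ?S = "unit_squares :: 'k set"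
  let ?T = "(\<lambda>s. a * s) ` ?S"
  have disj: "?S \<inter> ?T = {}"
    using assms(3) unit_squares_mult_cancel by (fastforce simp: mult.commute[of a])
  have "card ?T = card ?S"
    by (rule card_image) (use assms(1) in \<open>auto intro: inj_onI\<close>)
  then have "card (?S \<union> ?T) = 2 * card ?S"
    using disj by (simp add: card_Un_disjoint)
  moreover have "?S \<union> ?T \<subseteq> - {0, a * b}"
    using assms ab by (auto simp: unit_squares_iff)
  then have "card (?S \<union> ?T) \<le> card (- {0, a * b})"
    by (rule card_mono[rotated]) simp
  moreover have "card (- {0, a * b}) = CARD('k) - 2"
    using assms by (simp add: Compl_eq_Diff_UNIV)
  moreover have "card {0, a * b} \<le> CARD('k)" by (rule card_mono) auto
  ultimately show False using card_unit_squares[where 'k='k] assms by simp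
qed

text \<open>Pigeonhole: the values \<open>x * x\<close> and the values
  \<open>t + D * (y * y)\<close> each fill more than half of the field, so they meet.\<close>

lemma square_minus_mult_square_surj:
  fixes D t :: "'k::{field,finite}"
  assumes "D \<noteq> 0"
  shows "\<exists>x y. x * x - D * (y * y) = t"
proof -
  let ?S = "range (\<lambda>x :: 'k. x * x)"
  let ?T = "(\<lambda>s. t + D * s) ` ?S"
  have "?S = insert 0 unit_squares" by (auto simp: unit_squares_iff)
  moreover have "0 \<notin> (unit_squares :: 'k set)" by (auto simp: unit_squares_iff)
  ultimately have cS: "card ?S = card (unit_squares :: 'k set) + 1" by simp
  have cT: "card ?T = card ?S"
    by (rule card_image) (use assms in \<open>auto intro: inj_onI\<close>)
  have "?S \<inter> ?T \<noteq> {}"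
  proof
    assume "?S \<inter> ?T = {}"
    then have "card (?S \<union> ?T) = card ?S + card ?T" by (intro card_Un_disjoint) auto
    moreover have "card (?S \<union> ?T) \<le> CARD('k)" by (rule card_mono) auto
    ultimately show False using cS cT card_unit_squares[where 'k='k] by linarith
  qed
  then obtain x y where "x * x = t + D * (y * y)" by auto
  then show ?thesis by (intro exI[of _ x] exI[of _ y]) simp
qed

text \<open>Completing the square turns \<open>4 * a\<close> times the form into
  \<open>X * X - (b * b - 4 * a * c) * (y * y)\<close>. For \<open>a = 0\<close> the form is already
  affine in \<open>x\<close> on \<open>y = 1\<close>.\<close>

lemma binary_form_surj:
  fixes a b c t :: "'k::{field,finite}"
  assumes "(2 :: 'k) \<noteq> 0" and "b * b \<noteq> 4 * a * c"
  shows "\<exists>x y. a * (x * x) + b * (x * y) + c * (y * y) = t"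
proof (cases "a = 0")
  case True
  then have "b \<noteq> 0" using assms by auto
  then show ?thesis using True
    by (intro exI[of _ "(t - c) / b"] exI[of _ 1]) simp
next
  case False
  have "(4 :: 'k) = 2 * 2" by simp
  then have four: "(4 :: 'k) \<noteq> 0" using assms(1) by (metis mult_eq_0_iff)
  have "b * b - 4 * a * c \<noteq> 0" using assms(2) by simp
  then obtain X y where X: "X * X - (b * b - 4 * a * c) * (y * y) = 4 * a * t"
    using square_minus_mult_square_surj by blast
  define x where "x = (X - b * y) / (2 * a)"
  have Xx: "X = 2 * a * x + b * y" using False assms(1) by (simp add: x_def)
  have "4 * a * (a * (x * x) + b * (x * y) + c * (y * y)) = 4 * a * t"
    unfolding X[symmetric] Xx by (simp add: algebra_simps)
  then show ?thesis using False four by (metis mult_left_cancel mult_eq_0_iff)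
qed

section \<open>Kernels and determinants over finite fields\<close>

lemma carrier_vec_image_lists: "carrier_vec n = vec_of_list ` {xs. set xs \<subseteq> UNIV \<and> length xs = n}"
proof (intro Set.set_eqI iffI)
  fix v :: "'a vec" assume "v \<in> carrier_vec n"
  then show "v \<in> vec_of_list ` {xs. set xs \<subseteq> UNIV \<and> length xs = n}"
    by (intro image_eqI[of _ _ "list_of_vec v"]) (simp_all add: vec_list)
qed (auto intro!: carrier_vecI)

lemma finite_carrier_vec [simp]: "finite (carrier_vec n :: 'k::finite vec set)"
  unfolding carrier_vec_image_lists by (intro finite_imageI finite_lists_length_eq) simp

lemma card_carrier_vec: "card (carrier_vec n :: 'k::finite vec set) = CARD('k) ^ n"
proof -
  have "inj (vec_of_list :: 'k list \<Rightarrow> 'k vec)"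
    by (rule inj_on_inverseI[where g=list_of_vec]) (simp add: list_vec)
  then show ?thesis
    unfolding carrier_vec_image_lists
    using card_lists_length_eq[of "UNIV :: 'k set" n]
    by (subst card_image[OF inj_on_subset, of _ UNIV]) simp_all
qed

text \<open>Coordinates with respect to a basis \<open>S\<close> of the kernel identify it with the
  functions from \<open>S\<close> to the field.\<close>

lemma card_mat_kernel:
  fixes A :: "'k::{field,finite} mat"
  assumes A: "A \<in> carrier_mat nr nc"
  shows "card (mat_kernel A) = CARD('k) ^ kernel_dim A"
proof -
  interpret kernel nr nc A by unfold_locales (rule A)
  obtain S where S: "finite S" "basis S" using kernel_basis_exists[OF A] by blast
  then have sub: "S \<subseteq> mat_kernel A" by (simp add: Ker.basis_def)
  have crit: "\<exists>!a. a \<in> S \<rightarrow>\<^sub>E UNIV \<and> lincomb a S = v" if "v \<in> mat_kernel A" for v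
    using Ker.basis_criterion[OF S(1) sub] S(2) that by blast
  have "bij_betw (\<lambda>a. lincomb a S) (S \<rightarrow>\<^sub>E UNIV) (mat_kernel A)"
  proof (rule bij_betw_imageI)
    show "inj_on (\<lambda>a. lincomb a S) (S \<rightarrow>\<^sub>E UNIV)"
    proof (rule inj_onI)
      fix a b assume ab: "a \<in> S \<rightarrow>\<^sub>E UNIV" "b \<in> S \<rightarrow>\<^sub>E UNIV" "lincomb a S = lincomb b S"
      have "lincomb a S \<in> mat_kernel A" using Ker.lincomb_closed[OF sub] by auto
      then show "a = b" using crit ab by metis
    qed
    have "lincomb a S \<in> mat_kernel A" for a using Ker.lincomb_closed[OF sub] by auto
    then show "(\<lambda>a. lincomb a S) ` (S \<rightarrow>\<^sub>E UNIV) = mat_kernel A" using crit by blast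
  qed
  then have "card (mat_kernel A) = card (S \<rightarrow>\<^sub>E (UNIV :: 'k set))"
    by (rule bij_betw_same_card[symmetric])
  also have "\<dots> = CARD('k) ^ card S" by (simp add: card_PiE S(1))
  also have "card S = kernel_dim A" using Ker.dim_basis[OF S] by simp
  finally show ?thesis .
qed

lemma mult_mat_vec_zero:
  "A \<in> carrier_mat nr nc \<Longrightarrow> A *\<^sub>v 0\<^sub>v nc = (0\<^sub>v nr :: 'k::semiring_0 vec)"
  by (intro eq_vecI) auto

text \<open>It serves to move a kernel vector to the first basis vector in the induction of
  \<open>det_of_asymmetry\<close>.\<close>

lemma invertible_with_first_column:
  fixes x :: "'k::field vec"
  assumes x: "x \<in> carrier_vec n" and x0: "x \<noteq> 0\<^sub>v n"
  shows "\<exists>P \<in> carrier_mat n n. det P \<noteq> 0 \<and> P *\<^sub>v unit_vec n 0 = x"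
proof -
  obtain i where i: "i < n" "x $ i \<noteq> 0" using x x0 by (metis carrier_vecD eq_vecI index_zero_vec)
  \<comment> \<open>In the identity matrix \<open>x\<close> replaces column 0. If \<open>i\<close>
    is not 0, the displaced unit vector replaces column \<open>i\<close>, so that the columns stay
    independent.\<close>
  define P where "P = mat n n (\<lambda>(a, b). if b = 0 then x $ a
      else if b = i then (if a = 0 then 1 else 0) else (if a = b then 1 else 0))"
  have P: "P \<in> carrier_mat n n" by (simp add: P_def)
  have "y = 0\<^sub>v n" if y: "y \<in> carrier_vec n" and Py: "P *\<^sub>v y = 0\<^sub>v n" for y
  proof -
    have row: "(\<Sum>b = 0..<n. P $$ (a, b) * y $ b) = 0" if "a < n" for a
      using arg_cong[OF Py, of "\<lambda>v. v $ a"] that y P by (simp add: scalar_prod_def)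
    have split: "(\<Sum>b = 0..<n. P $$ (a, b) * y $ b) =
        x $ a * y $ 0 + (\<Sum>b \<in> {0..<n} - {0}. P $$ (a, b) * y $ b)" if "a < n" for a
      using that by (subst sum.remove[of _ 0]) (auto simp: P_def)
    \<comment> \<open>Row \<open>i\<close> has the entry \<open>x $ i\<close> in column 0 and is
      zero elsewhere.\<close>
    have y0: "y $ 0 = 0"
    proof (cases "i = 0")
      case True
      have "(\<Sum>b \<in> {0..<n} - {0}. P $$ (0, b) * y $ b) = 0"
        using True by (intro sum.neutral) (auto simp: P_def)
      then show ?thesis using row[of 0] split[of 0] i True by auto
    next
      case False
      have "(\<Sum>b \<in> {0..<n} - {0}. P $$ (i, b) * y $ b) = 0"
        using False i by (intro sum.neutral) (auto simp: P_def)
      then show ?thesis using row[of i] split[of i] i by auto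
    qed
    have "y $ b = 0" if b: "b < n" "b \<noteq> 0" for b
    proof -
      \<comment> \<open>Row \<open>a\<close> is the one whose only nonzero entry outside column 0 is
        the 1 in column \<open>b\<close>.\<close>
      define a where "a = (if b = i then 0 else b)"
      have a: "a < n" using b by (auto simp: a_def)
      have "(\<Sum>c \<in> {0..<n} - {0}. P $$ (a, c) * y $ c) = (\<Sum>c \<in> {0..<n} - {0}. if c = b then y $ b else 0)"
        using a b by (intro sum.cong) (auto simp: P_def a_def)
      also have "\<dots> = y $ b" using b by simp
      finally show ?thesis using row[OF a] split[OF a] y0 by simp
    qed
    then show ?thesis using y0 y by (metis carrier_vecD eq_vecI index_zero_vec)
  qed
  then have "det P \<noteq> 0" using det_0_iff_vec_prod_zero_field[OF P] by blast
  moreover have "P *\<^sub>v unit_vec n 0 = x"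
    using i x P by (intro eq_vecI) (auto simp: P_def mult_mat_vec_def scalar_prod_right_unit)
  ultimately show ?thesis using P by blast
qed

lemma det_nonzero_inverse:
  fixes P :: "'k::field mat"
  assumes "P \<in> carrier_mat n n" "det P \<noteq> 0"
  obtains P' where "P' \<in> carrier_mat n n" "P * P' = 1\<^sub>m n" "P' * P = 1\<^sub>m n"
  using det_non_zero_imp_unit[OF assms, of "()"] by (auto simp: Units_def ring_mat_def)

text \<open>This is Wall's argument: \<open>A\<close> induces a nondegenerate bilinear form on the quotient by its
  kernel, and \<open>g\<close> induces there the asymmetry of that form, up to the sign \<open>-1\<close>.\<close>

lemma det_of_asymmetry:
  fixes A g :: "'k::{field,finite} mat"
  assumes "A \<in> carrier_mat n n" "g \<in> carrier_mat n n"
    and "transpose_mat A * g = - A"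
    and "\<And>x. x \<in> carrier_vec n \<Longrightarrow> A *\<^sub>v x = 0\<^sub>v n \<Longrightarrow> g *\<^sub>v x = x"
  shows "\<exists>k \<le> n. card (mat_kernel A) = CARD('k) ^ k \<and> det g = (-1) ^ (n - k)"
  using assms
proof (induction n arbitrary: A g)
  case 0
  have "mat_kernel A = {0\<^sub>v 0}" unfolding mat_kernel[OF 0(1)] using 0(1) by auto
  moreover have "det g = 1" using 0(2) by (simp add: det_dim_zero)
  ultimately show ?case by simp
next
  case (Suc m)
  let ?n = "Suc m"
  note A = Suc.prems(1) and g = Suc.prems(2) and Ag = Suc.prems(3) and fixed = Suc.prems(4)
  show ?case
  proof (cases "det A = 0")
    case False
    have "mat_kernel A = {0\<^sub>v ?n}"
      using False A unfolding mat_kernel[OF A] det_0_iff_vec_prod_zero_field[OF A] by auto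
    \<comment> \<open>The kernel is trivial here, and taking determinants in
      \<open>transpose_mat A * g = - A\<close> gives the sign.\<close>
    moreover have "det A * det g = (-1) ^ ?n * det A"
    proof -
      have "det A * det g = det (transpose_mat A * g)"
        using A g by (simp add: det_mult[of _ ?n] det_transpose)
      also have "\<dots> = det ((-1) \<cdot>\<^sub>m A)" unfolding Ag by (rule arg_cong[of _ _ det]) auto
      also have "\<dots> = (-1) ^ ?n * det A" using A by (simp only: det_smult carrier_matD)
      finally show ?thesis .
    qed
    then have "det g = (-1) ^ ?n" using False by (metis mult.commute mult_left_cancel)
    ultimately show ?thesis by (intro exI[of _ 0]) simp
  next
    case True
    then obtain x where x: "x \<in> carrier_vec ?n" "x \<noteq> 0\<^sub>v ?n" "A *\<^sub>v x = 0\<^sub>v ?n"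
      using det_0_iff_vec_prod_zero_field[OF A] by auto
    obtain P where P: "P \<in> carrier_mat ?n ?n" "det P \<noteq> 0" "P *\<^sub>v unit_vec ?n 0 = x"
      using invertible_with_first_column[OF x(1,2)] by auto
    obtain P' where P': "P' \<in> carrier_mat ?n ?n" "P * P' = 1\<^sub>m ?n" "P' * P = 1\<^sub>m ?n"
      using det_nonzero_inverse[OF P(1,2)] by auto
    let ?e = "unit_vec ?n 0 :: 'k vec"
    let ?PT = "transpose_mat P"
    \<comment> \<open>In the new basis the bilinear form \<open>A\<close> changes by congruence and
      the endomorphism \<open>g\<close> by conjugation. Their relation, the size of the kernel and
      the determinant of \<open>g\<close> survive.\<close>
    define A' where "A' = ?PT * A * P"
    define g' where "g' = P' * g * P"
    have A': "A' \<in> carrier_mat ?n ?n" and g': "g' \<in> carrier_mat ?n ?n"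
      using A g P P' by (auto simp: A'_def g'_def)
    have gx: "g *\<^sub>v x = x" using fixed x by blast
    have A'v: "A' *\<^sub>v v = ?PT *\<^sub>v (A *\<^sub>v (P *\<^sub>v v))" if "v \<in> carrier_vec ?n" for v
      unfolding A'_def using that A P(1) by (simp add: assoc_mult_mat_vec[of _ ?n ?n _ ?n])
    have g'v: "g' *\<^sub>v v = P' *\<^sub>v (g *\<^sub>v (P *\<^sub>v v))" if "v \<in> carrier_vec ?n" for v
      unfolding g'_def using that g P'(1) P(1) by (simp add: assoc_mult_mat_vec[of _ ?n ?n _ ?n])
    have A'e: "A' *\<^sub>v ?e = 0\<^sub>v ?n" using P x mult_mat_vec_zero[of ?PT ?n ?n] by (simp add: A'v)
    have P'P: "P' *\<^sub>v (P *\<^sub>v v) = v" if "v \<in> carrier_vec ?n" for v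
      using that P P' by (simp add: assoc_mult_mat_vec[of _ ?n ?n _ ?n, symmetric])
    have PP': "P *\<^sub>v (P' *\<^sub>v v) = v" if "v \<in> carrier_vec ?n" for v
      using that P P' by (simp add: assoc_mult_mat_vec[of _ ?n ?n _ ?n, symmetric])
    have g'e: "g' *\<^sub>v ?e = ?e" using P gx P'P[of ?e] by (simp add: g'v)
    have A'T: "transpose_mat A' = ?PT * transpose_mat A * P"
      unfolding A'_def using A P(1)
      by (simp add: transpose_mult[of _ ?n ?n _ ?n] assoc_mult_mat[of _ ?n ?n _ ?n _ ?n])
    have A'g': "transpose_mat A' * g' = - A'"
    proof -
      have "transpose_mat A' * g' = ?PT * transpose_mat A * (P * P') * (g * P)"
        unfolding A'T g'_def using A P(1) P'(1) g
        by (simp add: assoc_mult_mat[of _ ?n ?n _ ?n _ ?n])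
      also have "\<dots> = ?PT * (transpose_mat A * g) * P"
        unfolding P'(2) using A P(1) g by (simp add: assoc_mult_mat[of _ ?n ?n _ ?n _ ?n])
      also have "\<dots> = - A'" unfolding Ag A'_def using A P(1) by simp
      finally show ?thesis .
    qed
    \<comment> \<open>Since \<open>g'\<close> fixes the first basis vector, the relation carries it
      from the right kernel of \<open>A'\<close> to the left kernel, so the first row vanishes along
      with the first column.\<close>
    have A'Te: "transpose_mat A' *\<^sub>v ?e = 0\<^sub>v ?n"
    proof -
      have "transpose_mat A' *\<^sub>v ?e = transpose_mat A' *\<^sub>v (g' *\<^sub>v ?e)" by (simp add: g'e)
      also have "\<dots> = (- A') *\<^sub>v ?e"
        using A' g' by (simp add: A'g'[symmetric] assoc_mult_mat_vec[of _ ?n ?n _ ?n])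
      also have "\<dots> = - (A' *\<^sub>v ?e)" using A' by (simp add: uminus_mult_mat_vec)
      finally show ?thesis using A'e by simp
    qed
    have ker_P: "A *\<^sub>v (P *\<^sub>v v) = 0\<^sub>v ?n"
      if v: "v \<in> carrier_vec ?n" "A' *\<^sub>v v = 0\<^sub>v ?n" for v
    proof -
      obtain R where R: "R \<in> carrier_mat ?n ?n" "R * ?PT = 1\<^sub>m ?n"
        using det_nonzero_inverse[of ?PT ?n] P by (auto simp: det_transpose)
      have "A *\<^sub>v (P *\<^sub>v v) = R *\<^sub>v (?PT *\<^sub>v (A *\<^sub>v (P *\<^sub>v v)))"
        using R A P(1) v by (simp add: assoc_mult_mat_vec[of R ?n ?n _ ?n, symmetric])
      also have "\<dots> = 0\<^sub>v ?n"
        using v mult_mat_vec_zero[OF R(1)] by (simp add: A'v[OF v(1), symmetric])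
      finally show ?thesis .
    qed
    have fixed': "g' *\<^sub>v v = v" if v: "v \<in> carrier_vec ?n" "A' *\<^sub>v v = 0\<^sub>v ?n" for v
      using fixed[of "P *\<^sub>v v"] ker_P[OF v] P P'P[OF v(1)] v by (simp add: g'v)
    have card': "card (mat_kernel A') = card (mat_kernel A)"
    proof (rule bij_betw_same_card[of "\<lambda>v. P *\<^sub>v v"], rule bij_betw_byWitness[where f'="\<lambda>v. P' *\<^sub>v v"])
      show "(\<lambda>v. P *\<^sub>v v) ` mat_kernel A' \<subseteq> mat_kernel A"
        using mat_kernelD[OF A'] ker_P P by (auto intro!: mat_kernelI[OF A])
      show "(\<lambda>v. P' *\<^sub>v v) ` mat_kernel A \<subseteq> mat_kernel A'"
        using mat_kernelD[OF A] P P' PP' by (auto intro!: mat_kernelI[OF A'] simp: A'v)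
    qed (use mat_kernelD[OF A'] mat_kernelD[OF A] P'P PP' in auto)
    have det': "det g' = det g"
    proof -
      have "det g' = det (P' * P) * det g"
        using g P(1) P'(1) by (simp add: g'_def det_mult[of _ ?n])
      then show ?thesis using P'(3) by simp
    qed
    have col0: "A' $$ (i, 0) = 0" if "i < ?n" for i
      using arg_cong[OF A'e, of "\<lambda>v. v $ i"] that A' by simp
    have row0: "A' $$ (0, i) = 0" if "i < ?n" for i
      using arg_cong[OF A'Te, of "\<lambda>v. v $ i"] that A' by simp
    have gcol0: "g' $$ (i, 0) = (if i = 0 then 1 else 0)" if "i < ?n" for i
      using arg_cong[OF g'e, of "\<lambda>v. v $ i"] that g' by simp
    \<comment> \<open>Now \<open>A'\<close> is zero outside its block \<open>A1\<close>, and
      \<open>g'\<close> is block triangular with a 1 in the corner. The blocks \<open>A1\<close> and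
      \<open>g1\<close> are what is induced on the quotient by the line of \<open>x\<close>.\<close>
    obtain z1 z2 z3 A1 where "split_block A' 1 1 = (z1, z2, z3, A1)" by (metis prod_cases4)
    note zs = split_block[OF this, of m m] and zdef = this
    obtain o1 b o3 g1 where "split_block g' 1 1 = (o1, b, o3, g1)" by (metis prod_cases4)
    note os = split_block[OF this, of m m] and odef = this
    have z: "z1 = 0\<^sub>m 1 1" "z2 = 0\<^sub>m 1 m" "z3 = 0\<^sub>m m 1"
      using zdef A' col0 row0 by (auto simp: split_block_def Let_def)
    have o: "o1 = 1\<^sub>m 1" "o3 = 0\<^sub>m m 1"
      using odef g' gcol0 by (auto simp: split_block_def Let_def)
    have A1: "A1 \<in> carrier_mat m m" and A'eq: "A' = four_block_mat (0\<^sub>m 1 1) (0\<^sub>m 1 m) (0\<^sub>m m 1) A1"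
      using zs A' z by auto
    have b: "b \<in> carrier_mat 1 m" and g1: "g1 \<in> carrier_mat m m"
      and g'eq: "g' = four_block_mat (1\<^sub>m 1) b (0\<^sub>m m 1) g1"
      using os g' o by auto
    have A1g1: "transpose_mat A1 * g1 = - A1"
    proof (rule eq_matI)
      fix i j assume "i < dim_row (- A1)" "j < dim_col (- A1)"
      then have ij: "i < m" "j < m" using A1 by auto
      have "transpose_mat A' * g' =
          four_block_mat (0\<^sub>m 1 1) (0\<^sub>m 1 m) (0\<^sub>m m 1) (transpose_mat A1 * g1)"
        unfolding A'eq g'eq using A1 b g1
        by (subst transpose_four_block_mat[of _ 1 1 _ m _ m], auto)
           (subst mult_four_block_mat[of _ 1 1 _ m _ m _ _ 1 _ m], auto)
      then have "(transpose_mat A1 * g1) $$ (i, j) = (transpose_mat A' * g') $$ (i + 1, j + 1)"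
        using ij A1 g1 by simp
      also have "\<dots> = (- A1) $$ (i, j)" unfolding A'g' using ij A1 by (simp add: A'eq)
      finally show "(transpose_mat A1 * g1) $$ (i, j) = (- A1) $$ (i, j)" .
    qed (use A1 g1 in auto)
    have A'vec: "A' *\<^sub>v (a @\<^sub>v y) = 0\<^sub>v 1 @\<^sub>v (A1 *\<^sub>v y)"
      if "a \<in> carrier_vec 1" "y \<in> carrier_vec m" for a y
      unfolding A'eq using that A1 by (subst mult_mat_vec_split) auto
    have zero_app: "0\<^sub>v ?n = 0\<^sub>v 1 @\<^sub>v (0\<^sub>v m :: 'k vec)" by (intro eq_vecI) auto
    have ker: "A' *\<^sub>v (a @\<^sub>v y) = 0\<^sub>v ?n \<longleftrightarrow> A1 *\<^sub>v y = 0\<^sub>v m"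
      if "a \<in> carrier_vec 1" "y \<in> carrier_vec m" for a y
      unfolding A'vec[OF that] zero_app by (subst append_vec_eq[of _ 1]) auto
    have "g1 *\<^sub>v y = y" if y: "y \<in> carrier_vec m" "A1 *\<^sub>v y = 0\<^sub>v m" for y
    proof -
      have "g' *\<^sub>v (0\<^sub>v 1 @\<^sub>v y) = 0\<^sub>v 1 @\<^sub>v y"
        using y ker[of "0\<^sub>v 1" y] append_carrier_vec[of "0\<^sub>v 1" 1 y m] by (intro fixed') auto
      moreover have "g' *\<^sub>v (0\<^sub>v 1 @\<^sub>v y) = (b *\<^sub>v y) @\<^sub>v (g1 *\<^sub>v y)"
        unfolding g'eq using y b g1 by (subst four_block_mat_mult_vec[of _ 1 1 _ m _ m]) auto
      ultimately have "(b *\<^sub>v y) @\<^sub>v (g1 *\<^sub>v y) = 0\<^sub>v 1 @\<^sub>v y" by simp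
      moreover have "b *\<^sub>v y \<in> carrier_vec 1" using b y by simp
      ultimately show ?thesis using append_vec_eq[of "b *\<^sub>v y" 1 "0\<^sub>v 1"] zero_carrier_vec by blast
    qed
    then obtain k where k: "k \<le> m" "card (mat_kernel A1) = CARD('k) ^ k" "det g1 = (-1) ^ (m - k)"
      using Suc.IH[OF A1 g1 A1g1] by blast
    have "det g' = det g1" unfolding g'eq
      using det_four_block_mat_lower_left_zero[of "1\<^sub>m 1" 1 b m "0\<^sub>m m 1" g1] b g1 by simp
    then have "det g = (-1) ^ (?n - Suc k)" using det' k by simp
    moreover have "card (mat_kernel A') = CARD('k) ^ Suc k"
    proof -
      \<comment> \<open>The first coordinate of a kernel vector of \<open>A'\<close> is free and
        adds one dimension.\<close>
      have "bij_betw (\<lambda>(a, y). a @\<^sub>v y) ((carrier_vec 1 :: 'k vec set) \<times> mat_kernel A1) (mat_kernel A')"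
        unfolding bij_betw_def
      proof (intro conjI inj_onI Set.set_eqI iffI)
        fix p q assume "p \<in> carrier_vec 1 \<times> mat_kernel A1" "q \<in> carrier_vec 1 \<times> mat_kernel A1"
          "(case p of (a, y) \<Rightarrow> a @\<^sub>v y) = (case q of (a, y) \<Rightarrow> a @\<^sub>v y)"
        then show "p = q"
          using append_vec_eq[of "fst p" 1 "fst q" "snd p" "snd q"]
          by (auto simp: case_prod_unfold prod_eq_iff mem_Times_iff)
      next
        fix v assume "v \<in> (\<lambda>(a, y). a @\<^sub>v y) ` ((carrier_vec 1 :: 'k vec set) \<times> mat_kernel A1)"
        then obtain a y where v: "v = a @\<^sub>v y" "a \<in> carrier_vec 1" "y \<in> mat_kernel A1" by auto
        then have y: "y \<in> carrier_vec m" "A1 *\<^sub>v y = 0\<^sub>v m" using mat_kernelD[OF A1] by auto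
        have "a @\<^sub>v y \<in> carrier_vec (1 + m)" using v y by (intro append_carrier_vec)
        then show "v \<in> mat_kernel A'"
          using v y ker[OF v(2) y(1)] by (intro mat_kernelI[OF A']) auto
      next
        fix v assume "v \<in> mat_kernel A'"
        then have v: "v \<in> carrier_vec (1 + m)" "A' *\<^sub>v v = 0\<^sub>v ?n" using mat_kernelD[OF A'] by auto
        let ?a = "vec_first v 1" and ?y = "vec_last v m"
        have veq: "v = ?a @\<^sub>v ?y" using v(1) by simp
        have "?y \<in> mat_kernel A1"
          using v(2) ker[of ?a ?y] unfolding veq[symmetric] by (intro mat_kernelI[OF A1]) auto
        then show "v \<in> (\<lambda>(a, y). a @\<^sub>v y) ` ((carrier_vec 1 :: 'k vec set) \<times> mat_kernel A1)"
          by (subst veq) (rule image_eqI[of _ _ "(?a, ?y)"], auto)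
      qed
      then have "card (mat_kernel A') = card ((carrier_vec 1 :: 'k vec set) \<times> mat_kernel A1)"
        by (rule bij_betw_same_card[symmetric])
      then show ?thesis by (simp add: card_cartesian_product card_carrier_vec k)
    qed
    ultimately show ?thesis using card' k(1) by (intro exI[of _ "Suc k"]) simp
  qed
qed

section \<open>Signs of involutions\<close>

text \<open>An involution is a product of disjoint transpositions, one for each pair of moved
  points; the induction splits off one of them.\<close>

lemma sign_on_involution:
  assumes "finite X" and "\<And>x. x \<in> X \<Longrightarrow> f x \<in> X" and "\<And>x. x \<in> X \<Longrightarrow> f (f x) = x"
  shows "\<exists>k. card {x \<in> X. f x \<noteq> x} = 2 * k \<and> sign_on X f = (-1) ^ k"
  using assms(2,3)
proof (induction "card {x \<in> X. f x \<noteq> x}" arbitrary: f rule: less_induct)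
  case less
  show ?case
  proof (cases "\<exists>x \<in> X. f x \<noteq> x")
    case False
    then have "sign_on X f = sign_on X id" by (intro sign_on_cong) auto
    moreover have "{x \<in> X. f x \<noteq> x} = {}" using False by auto
    ultimately show ?thesis by (metis card.empty mult_0_right power_0 sign_on_id)
  next
    case True
    then obtain x where x: "x \<in> X" "f x \<noteq> x" by auto
    let ?t = "Transposition.transpose x (f x)"
    \<comment> \<open>\<open>h\<close> is \<open>f\<close> with the pair \<open>x\<close>,
      \<open>f x\<close> frozen, so it moves two points fewer.\<close>
    define h where "h z = (if z \<in> {x, f x} then z else f z)" for z
    have hX: "h z \<in> X" "h (h z) = z" if "z \<in> X" for z
      using that less.prems x by (auto simp: h_def) metis+
    have moved: "{z \<in> X. f z \<noteq> z} = {z \<in> X. h z \<noteq> z} \<union> {x, f x}"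
      and disj: "{z \<in> X. h z \<noteq> z} \<inter> {x, f x} = {}"
      using x less.prems by (auto simp: h_def)
    have card: "card {z \<in> X. f z \<noteq> z} = card {z \<in> X. h z \<noteq> z} + 2"
      unfolding moved using disj x assms(1) by (subst card_Un_disjoint) auto
    have bij: "bij_betw h X X"
      by (rule bij_betw_byWitness[where f'=h]) (use hX in auto)
    have bijt: "bij_betw ?t X X"
      using x less.prems by (intro permutes_imp_bij permutes_swap_id) auto
    have "sign_on X f = sign_on X (?t \<circ> h)"
      by (rule sign_on_cong) (use x less.prems in \<open>auto simp: h_def Transposition.transpose_def, metis\<close>)
    also have "\<dots> = sign_on X ?t * sign_on X h"
      by (rule sign_on_compose[OF bijt bij assms(1)])
    also have "sign_on X ?t = -1" using x less.prems by (intro sign_on_transpose) auto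
    finally have "sign_on X f = - sign_on X h" by simp
    moreover obtain k where "card {z \<in> X. h z \<noteq> z} = 2 * k" "sign_on X h = (-1) ^ k"
      using less.hyps[of h] card hX by auto
    ultimately show ?thesis using card by (intro exI[of _ "Suc k"]) simp
  qed
qed

text \<open>The maps generate a Klein four-group, and the last hypothesis says that their product
  has no fixed point either. The action is free, and \<open>S\<close> is a union of orbits of size
  4.\<close>

lemma four_dvd_card_commuting_involutions:
  assumes "finite S"
    and "\<And>x. x \<in> S \<Longrightarrow> f x \<in> S" "\<And>x. x \<in> S \<Longrightarrow> g x \<in> S"
    and "\<And>x. x \<in> S \<Longrightarrow> f (f x) = x" "\<And>x. x \<in> S \<Longrightarrow> g (g x) = x"
    and "\<And>x. x \<in> S \<Longrightarrow> f (g x) = g (f x)"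
    and "\<And>x. x \<in> S \<Longrightarrow> f x \<noteq> x" "\<And>x. x \<in> S \<Longrightarrow> g x \<noteq> x" "\<And>x. x \<in> S \<Longrightarrow> f x \<noteq> g x"
  shows "4 dvd card S"
  using assms
proof (induction "card S" arbitrary: S rule: less_induct)
  case less
  show ?case
  proof (cases "S = {}")
    case False
    then obtain x where x: "x \<in> S" by auto
    note p = less.prems
    let ?O = "{x, f x, g x, f (g x)}"
    have fx: "f x \<in> S" and gx: "g x \<in> S" using p x by auto
    have ne: "f x \<noteq> x" "g x \<noteq> x" "f x \<noteq> g x" "f (g x) \<noteq> x" "f (g x) \<noteq> f x" "f (g x) \<noteq> g x"
      using p(7)[OF x] p(8)[OF x] p(9)[OF x] p(4)[OF x] p(4)[OF gx] p(7)[OF gx] by metis+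
    have O: "?O \<subseteq> S" "card ?O = 4"
      using x fx gx p(2)[OF gx] ne by (auto simp: card_insert_if)
    have clos: "f y \<notin> ?O" "g y \<notin> ?O" if "y \<in> S - ?O" for y
    proof -
      have y: "y \<in> S" "y \<notin> ?O" using that by auto
      have "f (f y) = y" "g (g y) = y" using p y by auto
      moreover have "f z \<in> ?O" "g z \<in> ?O" if "z \<in> ?O" for z
        using that p(4-6)[OF x] p(4-6)[OF gx] p(4-6)[OF fx] by auto
      ultimately show "f y \<notin> ?O" "g y \<notin> ?O" using y(2) by metis+
    qed
    have "card (S - ?O) = card S - 4" using O p(1) by (subst card_Diff_subset) (auto intro: finite_subset)
    moreover have "4 \<le> card S" using card_mono[OF p(1) O(1)] O(2) by simp
    moreover have "4 dvd card (S - ?O)"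
    proof (rule less.hyps)
      show "card (S - ?O) < card S" using calculation by simp
      show "f y \<in> S - ?O" "g y \<in> S - ?O" if "y \<in> S - ?O" for y using that clos[OF that] p by auto
    qed (use p in auto)
    ultimately show ?thesis by (metis dvd_refl dvd_diffD)
  qed simp
qed

section \<open>Quadratic spaces\<close>

lemma eq_vec_if_scalar_prods_eq:
  fixes a b :: "'k::field vec"
  assumes "a \<in> carrier_vec n" "b \<in> carrier_vec n"
    and "\<And>x. x \<in> carrier_vec n \<Longrightarrow> x \<bullet> a = x \<bullet> b"
  shows "a = b"
proof (rule eq_vecI)
  fix i assume "i < dim_vec b"
  then show "a $ i = b $ i" using assms(1,2) assms(3)[of "unit_vec n i"] by simp
qed (use assms in simp)

text \<open>\<open>M\<close> is the Gram matrix of the polar form, as in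
  \<open>reduced_form\<close>. Odd characteristic enters as \<open>2 \<noteq> 0\<close>.\<close>

locale quadratic_space =
  fixes n :: nat and M :: "'k::{field,finite} mat"
  assumes M: "M \<in> carrier_mat n n" and sym: "transpose_mat M = M"
    and nondeg: "det M \<noteq> 0" and two: "(2 :: 'k) \<noteq> 0"
begin

abbreviation V :: "'k vec set" where "V \<equiv> carrier_vec n"

definition bil :: "'k vec \<Rightarrow> 'k vec \<Rightarrow> 'k" where
  "bil x y = x \<bullet> (M *\<^sub>v y)"

definition Q :: "'k vec \<Rightarrow> 'k" where
  "Q v = bil v v / 2"

abbreviation OQ where "OQ \<equiv> carrier (orthogonal_group n Q)"

lemma M_mult_closed [simp]: "x \<in> V \<Longrightarrow> M *\<^sub>v x \<in> V"
  using M by simp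

lemma bil_commute: "x \<in> V \<Longrightarrow> y \<in> V \<Longrightarrow> bil x y = bil y x"
  using transpose_vec_mult_scalar[OF M, of y x] comm_scalar_prod[of y n "M *\<^sub>v x"]
  by (simp add: bil_def sym)

lemma bil_add_left: "x \<in> V \<Longrightarrow> y \<in> V \<Longrightarrow> z \<in> V \<Longrightarrow> bil (x + y) z = bil x z + bil y z"
  by (simp add: bil_def add_scalar_prod_distrib[of _ n])

lemma bil_add_right: "x \<in> V \<Longrightarrow> y \<in> V \<Longrightarrow> z \<in> V \<Longrightarrow> bil x (y + z) = bil x y + bil x z"
  by (simp add: bil_def mult_add_distrib_mat_vec[OF M] scalar_prod_add_distrib[of _ n])

lemma bil_smult_left: "x \<in> V \<Longrightarrow> y \<in> V \<Longrightarrow> bil (c \<cdot>\<^sub>v x) y = c * bil x y"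
  by (simp add: bil_def smult_scalar_prod_distrib[of _ n])

lemma bil_smult_right: "x \<in> V \<Longrightarrow> y \<in> V \<Longrightarrow> bil x (c \<cdot>\<^sub>v y) = c * bil x y"
  by (simp add: bil_def mult_mat_vec[OF M] scalar_prod_smult_distrib[of _ n])

lemmas bil_simps = bil_add_left bil_add_right bil_smult_left bil_smult_right

lemma bil_zero [simp]: "x \<in> V \<Longrightarrow> bil x (0\<^sub>v n) = 0" "x \<in> V \<Longrightarrow> bil (0\<^sub>v n) x = 0"
proof -
  have "(0 :: 'k) \<cdot>\<^sub>v 0\<^sub>v n = 0\<^sub>v n" by (intro eq_vecI) auto
  then show "x \<in> V \<Longrightarrow> bil x (0\<^sub>v n) = 0" "x \<in> V \<Longrightarrow> bil (0\<^sub>v n) x = 0"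
    using bil_smult_right[of x "0\<^sub>v n" 0] bil_smult_left[of "0\<^sub>v n" x 0] by auto
qed

lemma bil_self: "bil v v = 2 * Q v"
  using two by (simp add: Q_def)

lemma Q_add:
  assumes "x \<in> V" "y \<in> V"
  shows "Q (x + y) = Q x + Q y + bil x y"
proof -
  have "2 * Q (x + y) = 2 * (Q x + Q y + bil x y)"
    using assms bil_commute[of x y]
    by (simp add: bil_self[symmetric] bil_simps algebra_simps)
  then show ?thesis using two mult_left_cancel by blast
qed

lemma Q_smult: "v \<in> V \<Longrightarrow> Q (c \<cdot>\<^sub>v v) = c * c * Q v"
  by (simp add: Q_def bil_simps)

lemma polar_Q: "x \<in> V \<Longrightarrow> y \<in> V \<Longrightarrow> polar Q x y = bil x y"
  by (simp add: polar_def Q_add)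

lemma bil_nondegenerate:
  assumes "y \<in> V" and "\<And>x. x \<in> V \<Longrightarrow> bil x y = 0"
  shows "y = 0\<^sub>v n"
proof -
  have "M *\<^sub>v y = 0\<^sub>v n"
    by (rule eq_vec_if_scalar_prods_eq[of _ n]) (use assms in \<open>auto simp: bil_def\<close>)
  then show ?thesis using nondeg det_0_iff_vec_prod_zero_field[OF M] assms(1) by blast
qed

subsection \<open>Subspaces and orthogonal complements\<close>

definition is_subspace :: "'k vec set \<Rightarrow> bool" where
  "is_subspace U \<longleftrightarrow> U \<subseteq> V \<and> 0\<^sub>v n \<in> U \<and> (\<forall>x\<in>U. \<forall>y\<in>U. x + y \<in> U) \<and> (\<forall>c. \<forall>x\<in>U. c \<cdot>\<^sub>v x \<in> U)"

definition perp :: "'k vec set \<Rightarrow> 'k vec set" where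
  "perp S = {v \<in> V. \<forall>x\<in>S. bil x v = 0}"

lemma subspace_V: "is_subspace V"
  by (auto simp: is_subspace_def)

lemma subspace_perp: "S \<subseteq> V \<Longrightarrow> is_subspace (perp S)"
  by (auto simp: is_subspace_def perp_def bil_simps subset_iff)

lemma finite_subspace: "is_subspace U \<Longrightarrow> finite U"
  using finite_subset[OF _ finite_carrier_vec] by (auto simp: is_subspace_def)

text \<open>Translation by a vector of \<open>U\<close> with value \<open>c\<close> is a bijection
  between the two sets.\<close>

lemma card_level_set:
  assumes U: "is_subspace U" and y: "y \<in> V" and ne: "\<exists>u\<in>U. bil u y \<noteq> 0"
  shows "card {u \<in> U. bil u y = c} = card {u \<in> U. bil u y = 0}"
proof -
  obtain u where u: "u \<in> U" "bil u y \<noteq> 0" using ne by auto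
  have UV: "U \<subseteq> V" using U by (simp add: is_subspace_def)
  define w where "w = (c / bil u y) \<cdot>\<^sub>v u"
  have w: "w \<in> U" "w \<in> V" "bil w y = c" "(-1) \<cdot>\<^sub>v w \<in> U"
    using U u UV y by (auto simp: w_def is_subspace_def bil_simps subset_iff)
  have "bij_betw (\<lambda>x. x + w) {u \<in> U. bil u y = 0} {u \<in> U. bil u y = c}"
  proof (rule bij_betw_byWitness[where f'="\<lambda>x. x + (-1) \<cdot>\<^sub>v w"])
    show "\<forall>x\<in>{u \<in> U. bil u y = 0}. x + w + (- 1) \<cdot>\<^sub>v w = x"
      "\<forall>x\<in>{u \<in> U. bil u y = c}. x + (- 1) \<cdot>\<^sub>v w + w = x"
      using UV w(2) by (auto intro!: eq_vecI)
    show "(\<lambda>x. x + w) ` {u \<in> U. bil u y = 0} \<subseteq> {u \<in> U. bil u y = c}"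
      "(\<lambda>x. x + (- 1) \<cdot>\<^sub>v w) ` {u \<in> U. bil u y = c} \<subseteq> {u \<in> U. bil u y = 0}"
      using U UV w y by (auto simp: is_subspace_def bil_simps subset_iff)
  qed
  then show ?thesis by (rule bij_betw_same_card[symmetric])
qed

lemma card_subspace_level_sets:
  assumes U: "is_subspace U"
  shows "card U = (\<Sum>c\<in>UNIV. card {u \<in> U. bil u y = c})"
proof -
  have "U = (\<Union>c. {u \<in> U. bil u y = c})" by auto
  then have "card U = card (\<Union>c. {u \<in> U. bil u y = c})" by simp
  also have "\<dots> = (\<Sum>c\<in>UNIV. card {u \<in> U. bil u y = c})"
    using finite_subspace[OF U] by (intro card_UN_disjoint) auto
  finally show ?thesis .
qed

lemma card_subspace_le_hyperplane:
  assumes U: "is_subspace U" and y: "y \<in> V"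
  shows "card U \<le> CARD('k) * card {u \<in> U. bil u y = 0}"
proof (cases "\<exists>u\<in>U. bil u y \<noteq> 0")
  case True
  have "card U = (\<Sum>c\<in>(UNIV :: 'k set). card {u \<in> U. bil u y = 0})"
    unfolding card_subspace_level_sets[OF U, of y]
    by (intro sum.cong refl card_level_set[OF U y True])
  then show ?thesis by simp
next
  case False
  then have "{u \<in> U. bil u y = 0} = U" by auto
  then show ?thesis by simp
qed

text \<open>Each vector of \<open>S\<close> imposes one linear condition and costs at most a factor
  \<open>CARD('k)\<close>.\<close>

lemma card_perp_ge:
  assumes "finite S" "S \<subseteq> V"
  shows "CARD('k) ^ n \<le> CARD('k) ^ card S * card (perp S)"
  using assms
proof (induction S rule: finite_induct)
  case empty
  have "perp {} = V" by (auto simp: perp_def)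
  then show ?case by (simp add: card_carrier_vec)
next
  case (insert x S)
  have x: "x \<in> V" and S: "S \<subseteq> V" using insert.prems by auto
  have "perp (insert x S) = {u \<in> perp S. bil u x = 0}"
    using x by (auto simp: perp_def bil_commute[of x])
  then have "card (perp S) \<le> CARD('k) * card (perp (insert x S))"
    using card_subspace_le_hyperplane[OF subspace_perp[OF S] x] by simp
  then have "CARD('k) ^ card S * card (perp S) \<le> CARD('k) ^ card (insert x S) * card (perp (insert x S))"
    using insert.hyps by (simp add: mult.assoc mult.left_commute)
  then show ?case using insert.IH[OF S] by linarith
qed

text \<open>Counting the pairs with \<open>bil u y = 0\<close> against those with \<open>bil u y = 1\<close> replaces the
  orthogonality relations of an additive character.\<close>

lemma card_times_card_perp:
  assumes U: "is_subspace U"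
  shows "card U * card (perp U) = CARD('k) ^ n"
proof -
  define f :: "'k \<Rightarrow> int" where "f c = of_bool (c = 0) - of_bool (c = 1)" for c
  \<comment> \<open>If the functional does not vanish on \<open>W\<close>, its level sets have equal
    size and the two counts cancel.\<close>
  have f: "(\<Sum>u\<in>W. f (bil u y)) = (if \<forall>u\<in>W. bil u y = 0 then int (card W) else 0)"
    if W: "is_subspace W" and y: "y \<in> V" for W y
  proof -
    have fin: "finite W" by (rule finite_subspace[OF W])
    have "(\<Sum>u\<in>W. f (bil u y)) =
        int (card {u \<in> W. bil u y = 0}) - int (card {u \<in> W. bil u y = 1})"
      using fin by (simp add: f_def sum_subtractf sum_of_bool_eq Int_def)
    moreover have "{u \<in> W. bil u y = 0} = W" "{u \<in> W. bil u y = 1} = {}"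
      if "\<forall>u\<in>W. bil u y = 0" using that by auto
    ultimately show ?thesis
      using card_level_set[OF W y, of 1] by (cases "\<forall>u\<in>W. bil u y = 0") (simp_all only: card.empty, auto)
  qed
  have UV: "U \<subseteq> V" and U0: "0\<^sub>v n \<in> U" using U by (auto simp: is_subspace_def)
  \<comment> \<open>Double counting: summing over \<open>u\<close> first leaves only the
    \<open>y\<close> in \<open>perp U\<close>; summing over \<open>y\<close> first leaves only
    \<open>u = 0\<close>, by nondegeneracy.\<close>
  have "int (card U * card (perp U)) = (\<Sum>y\<in>perp U. int (card U))" by simp
  also have "\<dots> = (\<Sum>y\<in>V. if y \<in> perp U then int (card U) else 0)"
    by (rule sum.mono_neutral_cong_left) (auto simp: perp_def)
  also have "\<dots> = (\<Sum>y\<in>V. \<Sum>u\<in>U. f (bil u y))"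
    by (rule sum.cong) (auto simp: f[OF U] perp_def)
  also have "\<dots> = (\<Sum>u\<in>U. \<Sum>y\<in>V. f (bil u y))" by (rule sum.swap)
  also have "\<dots> = (\<Sum>u\<in>U. \<Sum>y\<in>V. f (bil y u))"
    using UV by (intro sum.cong refl) (auto simp: bil_commute subset_iff)
  also have "\<dots> = (\<Sum>u\<in>U. if u = 0\<^sub>v n then int (card V) else 0)"
    using UV by (intro sum.cong refl) (auto simp: f[OF subspace_V] subset_iff dest: bil_nondegenerate)
  also have "\<dots> = int (card V)" using U0 finite_subspace[OF U] by simp
  finally show ?thesis by (simp only: of_nat_eq_iff card_carrier_vec)
qed

text \<open>A pair in \<open>perp S\<close> with nonzero discriminant spans a plane on which
  \<open>Q\<close> takes all values. Without such a pair the form has rank at most one on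
  \<open>perp S\<close>, so its radical there has index at most \<open>CARD('k)\<close>. The radical
  also lies in \<open>perp (perp S)\<close>, which is too small for this by
  \<open>card_times_card_perp\<close>.\<close>

lemma Q_surj_on_perp:
  assumes S: "finite S" "S \<subseteq> V" and n: "2 * card S + 2 \<le> n"
  shows "\<exists>v\<in>perp S. Q v = t"
proof -
  let ?U = "perp S" and ?q = "CARD('k)"
  have U: "is_subspace ?U" by (rule subspace_perp[OF S(2)])
  have UV: "?U \<subseteq> V" by (auto simp: perp_def)
  have q: "?q > 1"
  proof -
    have "card {0, 1 :: 'k} \<le> ?q" by (rule card_mono) auto
    then show ?thesis by simp
  qed
  have "\<exists>u\<in>?U. \<exists>v\<in>?U. bil u v * bil u v \<noteq> 4 * Q u * Q v"
  proof (rule ccontr)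
    assume "\<not> ?thesis"
    then have eq: "bil u v * bil u v = 4 * Q u * Q v" if "u \<in> ?U" "v \<in> ?U" for u v
      using that by auto
    \<comment> \<open>If \<open>Q y\<close> is nonzero, vanishing discriminants put every vector of
      \<open>perp S\<close> orthogonal to \<open>y\<close> into the radical. If \<open>Q\<close>
      vanishes on \<open>perp S\<close>, so does the bilinear form, and \<open>y = 0\<close>
      serves.\<close>
    obtain y where y: "y \<in> V" "{u \<in> ?U. bil u y = 0} \<subseteq> perp ?U"
    proof (cases "\<exists>v\<in>?U. Q v \<noteq> 0")
      case True
      then obtain y where y: "y \<in> ?U" "Q y \<noteq> 0" by auto
      have four: "(4 :: 'k) \<noteq> 0" using two by (metis mult_2 mult_eq_0_iff numeral_Bit0)
      have "u \<in> perp ?U" if u: "u \<in> ?U" "bil u y = 0" for u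
      proof -
        have "Q u = 0" using eq[OF u(1) y(1)] u(2) y(2) four by simp
        then have "bil u v = 0" if "v \<in> ?U" for v using eq[OF u(1) that] by simp
        then show ?thesis using u(1) UV bil_commute unfolding perp_def[of ?U] by (auto simp: subset_iff)
      qed
      then show ?thesis using that[of y] y(1) UV by auto
    next
      case False
      then have "bil u v = 0" if "u \<in> ?U" "v \<in> ?U" for u v using eq[OF that] that by simp
      then have "?U \<subseteq> perp ?U" using UV unfolding perp_def[of ?U] by auto
      then show ?thesis using that[of "0\<^sub>v n"] by auto
    qed
    have "card ?U \<le> ?q * card {u \<in> ?U. bil u y = 0}"
      by (rule card_subspace_le_hyperplane[OF U y(1)])
    also have "card {u \<in> ?U. bil u y = 0} \<le> card (perp ?U)"
      by (rule card_mono[OF finite_subspace[OF subspace_perp[OF UV]] y(2)])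
    finally have "card ?U * card ?U \<le> card ?U * (?q * card (perp ?U))" by simp
    also have "\<dots> = ?q * ?q ^ n" using card_times_card_perp[OF U] by (simp add: mult.left_commute)
    finally have le: "card ?U * card ?U \<le> ?q ^ (n + 1)" by simp
    have ge: "?q ^ n \<le> ?q ^ card S * card ?U" by (rule card_perp_ge[OF S])
    have "?q ^ (n + n) \<le> (?q ^ card S * card ?U) * (?q ^ card S * card ?U)"
      unfolding power_add by (rule mult_mono[OF ge ge]) auto
    also have "\<dots> = ?q ^ (2 * card S) * (card ?U * card ?U)"
      by (simp add: power_mult power2_eq_square power_mult_distrib mult_2 power_add)
    also have "\<dots> \<le> ?q ^ (2 * card S) * ?q ^ (n + 1)" using le by simp
    also have "\<dots> = ?q ^ (2 * card S + n + 1)" by (simp add: power_add)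
    \<comment> \<open>Comparing exponents gives \<open>n \<le> 2 * card S + 1\<close>, one below the
      assumed bound.\<close>
    finally have "n + n \<le> 2 * card S + n + 1" using power_le_imp_le_exp[OF q] by blast
    then show False using n by simp
  qed
  then obtain u v where uv: "u \<in> ?U" "v \<in> ?U" "bil u v * bil u v \<noteq> 4 * Q u * Q v" by auto
  obtain x y where xy: "Q u * (x * x) + bil u v * (x * y) + Q v * (y * y) = t"
    using binary_form_surj[OF two uv(3)] by blast
  have "x \<cdot>\<^sub>v u + y \<cdot>\<^sub>v v \<in> ?U" using U uv by (simp add: is_subspace_def)
  moreover have "Q (x \<cdot>\<^sub>v u + y \<cdot>\<^sub>v v) = t"
    using uv UV xy by (auto simp: Q_add Q_smult bil_simps subset_iff algebra_simps)
  ultimately show ?thesis by blast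
qed

end

section \<open>The group of square classes\<close>

lemma mult_unit_group: "(\<otimes>\<^bsub>unit_group\<^esub>) = ((*) :: 'k::field \<Rightarrow> _)"
  by (simp add: unit_group_def units_of_def class_ring_simps)

lemma square_class_eq_image: "square_class (a :: 'k::field) = (\<lambda>s. s * a) ` unit_squares"
  by (auto simp: square_class_def r_coset_def mult_unit_group)

lemma one_square_classes: "\<one>\<^bsub>square_classes\<^esub> = (unit_squares :: 'k::field set)"
  by (simp add: square_classes_def FactGroup_def)

lemma one_in_unit_squares: "(1 :: 'k::field) \<in> unit_squares"
  by (auto simp: unit_squares_iff intro: exI[of _ 1])

lemma carrier_square_classes:
  "carrier square_classes = square_class ` (- {0 :: 'k::field})"
  by (auto simp: square_classes_def FactGroup_def RCOSETS_def square_class_def carrier_unit_group)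

lemma square_class_mult:
  "square_class a \<otimes>\<^bsub>square_classes\<^esub> square_class b = square_class (a * b :: 'k::field)"
proof -
  have "square_class a \<otimes>\<^bsub>square_classes\<^esub> square_class b =
      {x * y | x y. x \<in> square_class a \<and> y \<in> square_class b}"
    by (auto simp: square_classes_def FactGroup_def set_mult_def mult_unit_group)
  also have "\<dots> = square_class (a * b)"
  proof (intro equalityI subsetI)
    fix z assume "z \<in> {x * y | x y. x \<in> square_class a \<and> y \<in> square_class b}"
    then obtain s t where "s \<in> unit_squares" "t \<in> unit_squares" "z = (s * a) * (t * b)"
      by (auto simp: square_class_eq_image)
    then have "z = (s * t) * (a * b)" "s * t \<in> unit_squares"
      by (simp_all add: unit_squares_mult ac_simps)
    then show "z \<in> square_class (a * b)" by (auto simp: square_class_eq_image)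
  next
    fix z assume "z \<in> square_class (a * b)"
    then obtain s where s: "s \<in> unit_squares" "z = s * (a * b)"
      by (auto simp: square_class_eq_image)
    then have "z = (s * a) * (1 * b)" by (simp add: ac_simps)
    then show "z \<in> {x * y | x y. x \<in> square_class a \<and> y \<in> square_class b}"
      using s(1) one_in_unit_squares unfolding square_class_eq_image by blast
  qed
  finally show ?thesis .
qed

lemma square_class_eq_one_iff:
  "square_class (a :: 'k::field) = \<one>\<^bsub>square_classes\<^esub> \<longleftrightarrow> a \<in> unit_squares"
proof
  assume "square_class a = \<one>\<^bsub>square_classes\<^esub>"
  then have "1 * a \<in> unit_squares"
    using one_in_unit_squares unfolding square_class_eq_image one_square_classes by blast
  then show "a \<in> unit_squares" by simp
next
  assume a: "a \<in> unit_squares"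
  then have a0: "a \<noteq> 0" by (auto simp: unit_squares_iff)
  show "square_class a = \<one>\<^bsub>square_classes\<^esub>"
    unfolding one_square_classes square_class_eq_image
  proof (intro equalityI subsetI)
    fix z :: 'k assume "z \<in> unit_squares"
    then have "z * inverse a \<in> unit_squares" "z = z * inverse a * a"
      using a a0 by (simp_all add: unit_squares_mult unit_squares_inverse)
    then show "z \<in> (\<lambda>s. s * a) ` unit_squares" by blast
  qed (use a in \<open>auto intro: unit_squares_mult\<close>)
qed

lemma square_class_eqI:
  assumes "s \<in> unit_squares" "b = s * a"
  shows "square_class (a :: 'k::field) = square_class b"
proof -
  have "square_class b = square_class s \<otimes>\<^bsub>square_classes\<^esub> square_class a"
    using assms by (simp add: square_class_mult)
  also have "square_class s = square_class 1"
    using assms one_in_unit_squares square_class_eq_one_iff by metis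
  finally show ?thesis by (simp add: square_class_mult)
qed

text \<open>By \<open>nonsquare_mult\<close> there are at most two square classes, so a nontrivial
  factor exchanges them.\<close>

lemma square_classes_mult_nontrivial:
  fixes x y :: "'k::{field,finite} set"
  assumes "x \<in> carrier square_classes" "y \<in> carrier square_classes" "x \<noteq> \<one>\<^bsub>square_classes\<^esub>"
  shows "x \<otimes>\<^bsub>square_classes\<^esub> y = \<one>\<^bsub>square_classes\<^esub> \<longleftrightarrow> y \<noteq> \<one>\<^bsub>square_classes\<^esub>"
proof -
  obtain a b where ab: "x = square_class a" "y = square_class b" "a \<noteq> 0" "b \<noteq> 0"
    using assms by (auto simp: carrier_square_classes)
  then have "a \<notin> unit_squares" using assms(3) square_class_eq_one_iff by blast
  then have "a * b \<in> unit_squares \<longleftrightarrow> b \<notin> unit_squares"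
    using nonsquare_mult[of a b] unit_squares_mult_cancel[of b a] ab by (auto simp: mult.commute)
  then show ?thesis by (simp add: ab square_class_mult square_class_eq_one_iff)
qed

lemma minus_vec_eq_zeroD:
  fixes x y :: "'k::field vec"
  assumes "x \<in> carrier_vec n" "y \<in> carrier_vec n" "x - y = 0\<^sub>v n"
  shows "x = y"
proof (rule eq_vecI)
  fix i assume "i < dim_vec y"
  then show "x $ i = y $ i"
    using arg_cong[OF assms(3), of "\<lambda>v. v $ i"] assms(1,2) by simp
qed (use assms in simp)

lemma eq_mat_if_vecs_eq:
  fixes A B :: "'k::field mat"
  assumes "A \<in> carrier_mat nr nc" "B \<in> carrier_mat nr nc"
    and "\<And>v. v \<in> carrier_vec nc \<Longrightarrow> A *\<^sub>v v = B *\<^sub>v v"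
  shows "A = B"
proof (rule eq_matI)
  fix i j assume "i < dim_row B" "j < dim_col B"
  then show "A $$ (i, j) = B $$ (i, j)"
    using arg_cong[OF assms(3)[of "unit_vec nc j"], of "\<lambda>v. v $ i"] assms(1,2) by simp
qed (use assms in simp_all)

context quadratic_space
begin

section \<open>The orthogonal group and its reflections\<close>

lemma O_D:
  assumes "g \<in> OQ"
  shows "g \<in> carrier_mat n n" "v \<in> V \<Longrightarrow> g *\<^sub>v v \<in> V" "v \<in> V \<Longrightarrow> Q (g *\<^sub>v v) = Q v"
  using assms by (auto simp: orthogonal_group_def)

lemma bil_preserved:
  assumes "g \<in> carrier_mat n n" "\<And>v. v \<in> V \<Longrightarrow> Q (g *\<^sub>v v) = Q v" "x \<in> V" "y \<in> V"
  shows "bil (g *\<^sub>v x) (g *\<^sub>v y) = bil x y"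
proof -
  have "Q (g *\<^sub>v x + g *\<^sub>v y) = Q (x + y)"
    using assms by (simp add: mult_add_distrib_mat_vec[OF assms(1), symmetric])
  then show ?thesis using assms by (simp add: Q_add)
qed

text \<open>Invertibility is automatic: a vector killed by an isometry lies in the radical, which is
  zero.\<close>

lemma O_I:
  assumes g: "g \<in> carrier_mat n n" and Qg: "\<And>v. v \<in> V \<Longrightarrow> Q (g *\<^sub>v v) = Q v"
  shows "g \<in> OQ"
proof -
  have "x = 0\<^sub>v n" if x: "x \<in> V" "g *\<^sub>v x = 0\<^sub>v n" for x
  proof (rule bil_nondegenerate[OF x(1)])
    fix y assume y: "y \<in> V"
    then show "bil y x = 0" using bil_preserved[OF g Qg y x(1)] x(2) g by simp
  qed
  then have "det g \<noteq> 0" using det_0_iff_vec_prod_zero_field[OF g] by blast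
  then obtain g' where "g' \<in> carrier_mat n n" "g * g' = 1\<^sub>m n" "g' * g = 1\<^sub>m n"
    using det_nonzero_inverse[OF g] by blast
  then have "invertible_mat g"
    using g by (auto simp: invertible_mat_def inverts_mat_def intro!: exI[of _ g'])
  then show ?thesis using g Qg by (simp add: orthogonal_group_def)
qed

lemma O_mult_apply: "g \<in> OQ \<Longrightarrow> h \<in> OQ \<Longrightarrow> v \<in> V \<Longrightarrow> (g * h) *\<^sub>v v = g *\<^sub>v (h *\<^sub>v v)"
  using O_D(1) by (simp add: assoc_mult_mat_vec[of _ n n _ n])

lemma O_mult: "g \<in> OQ \<Longrightarrow> h \<in> OQ \<Longrightarrow> g * h \<in> OQ"
  using O_D mult_carrier_mat[OF O_D(1) O_D(1)] by (intro O_I) (auto simp: O_mult_apply)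

lemma O_inj: "g \<in> OQ \<Longrightarrow> inj_on (\<lambda>x. g *\<^sub>v x) V"
proof (rule inj_onI)
  fix x y assume g: "g \<in> OQ" and xy: "x \<in> V" "y \<in> V" "g *\<^sub>v x = g *\<^sub>v y"
  have "x - y = 0\<^sub>v n"
  proof (rule bil_nondegenerate)
    fix z assume z: "z \<in> V"
    have "bil z x = bil z y"
      using bil_preserved[OF O_D(1,3)[OF g] z xy(1)] bil_preserved[OF O_D(1,3)[OF g] z xy(2)] xy(3)
      by simp
    then show "bil z (x - y) = 0"
      using z xy M by (simp add: bil_def mult_minus_distrib_mat_vec scalar_prod_minus_distrib[of _ n])
  qed (use xy in simp)
  then show "x = y" using minus_vec_eq_zeroD xy by blast
qed

text \<open>The rank-one modification of the identity matrix by \<open>v\<close> and the functional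
  \<open>bil _ v\<close>, which is the reflection in \<open>v\<close> when
  \<open>Q v \<noteq> 0\<close>.\<close>

definition refl_mat :: "'k vec \<Rightarrow> 'k mat" where
  "refl_mat v = mat n n (\<lambda>(i, j). (if i = j then 1 else 0) - v $ i * (M *\<^sub>v v) $ j / Q v)"

lemma refl_carrier: "refl_mat v \<in> carrier_mat n n"
  by (simp add: refl_mat_def)

lemma refl_apply:
  assumes v: "v \<in> V" and w: "w \<in> V"
  shows "refl_mat v *\<^sub>v w = w + (- (bil w v / Q v)) \<cdot>\<^sub>v v"
proof (rule eq_vecI)
  fix i assume "i < dim_vec (w + (- (bil w v / Q v)) \<cdot>\<^sub>v v)"
  then have i: "i < n" using v by simp
  have Mv: "dim_vec (M *\<^sub>v v) = n" using M by simp
  have "(refl_mat v *\<^sub>v w) $ i = (\<Sum>j = 0..<n. ((if i = j then 1 else 0) - v $ i * (M *\<^sub>v v) $ j / Q v) * w $ j)"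
    using i w by (simp add: refl_mat_def scalar_prod_def)
  also have "\<dots> = (\<Sum>j = 0..<n. (if i = j then w $ j else 0) - (v $ i / Q v) * (w $ j * (M *\<^sub>v v) $ j))"
    by (rule sum.cong) (auto simp: algebra_simps)
  also have "\<dots> = w $ i - (\<Sum>j = 0..<n. (v $ i / Q v) * (w $ j * (M *\<^sub>v v) $ j))"
    using i by (simp add: sum_subtractf)
  also have "\<dots> = w $ i - (v $ i / Q v) * bil w v"
    unfolding bil_def scalar_prod_def Mv sum_distrib_left ..
  finally show "(refl_mat v *\<^sub>v w) $ i = (w + (- (bil w v / Q v)) \<cdot>\<^sub>v v) $ i"
    using i v w by (simp add: mult.commute)
qed (use v in \<open>simp add: refl_mat_def\<close>)

lemma refl_reflection:
  assumes "v \<in> V" "w \<in> V"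
  shows "refl_mat v *\<^sub>v w = reflection Q v w"
  using assms by (intro eq_vecI) (auto simp: refl_apply reflection_def polar_Q)

lemma refl_O: "v \<in> V \<Longrightarrow> Q v \<noteq> 0 \<Longrightarrow> refl_mat v \<in> OQ"
  by (rule O_I) (auto simp: refl_carrier refl_apply Q_add Q_smult bil_simps)

lemma refl_fix: "v \<in> V \<Longrightarrow> w \<in> V \<Longrightarrow> bil w v = 0 \<Longrightarrow> refl_mat v *\<^sub>v w = w"
  by (auto simp: refl_apply intro!: eq_vecI)

lemma refl_fix_iff:
  assumes "v \<in> V" "w \<in> V" "Q v \<noteq> 0"
  shows "refl_mat v *\<^sub>v w = w \<longleftrightarrow> bil w v = 0"
proof
  assume "refl_mat v *\<^sub>v w = w"
  then have "bil (w + (- (bil w v / Q v)) \<cdot>\<^sub>v v) v = bil w v" using assms by (simp add: refl_apply)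
  then show "bil w v = 0" using assms two by (simp add: bil_simps bil_self)
qed (use assms refl_fix in blast)

lemma refl_refl:
  assumes "v \<in> V" "w \<in> V" "Q v \<noteq> 0"
  shows "refl_mat v *\<^sub>v (refl_mat v *\<^sub>v w) = w"
  using assms by (intro eq_vecI) (auto simp: refl_apply bil_simps bil_self field_simps)

lemma refl_mult_self:
  assumes "v \<in> V" "Q v \<noteq> 0"
  shows "refl_mat v * refl_mat v = 1\<^sub>m n"
  using assms refl_carrier[of v]
  by (intro eq_mat_if_vecs_eq[of _ n n]) (auto simp: assoc_mult_mat_vec[of _ n n _ n] refl_refl)

subsection \<open>The spinor norm\<close>

definition level :: "'k \<Rightarrow> 'k vec set" where
  "level a = {x \<in> V. Q x = a}"

lemma O_bij_level: "g \<in> OQ \<Longrightarrow> bij_betw (\<lambda>x. g *\<^sub>v x) (level a) (level a)"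
proof -
  assume g: "g \<in> OQ"
  have inj: "inj_on (\<lambda>x. g *\<^sub>v x) (level a)"
    by (rule inj_on_subset[OF O_inj[OF g]]) (auto simp: level_def)
  moreover have "(\<lambda>x. g *\<^sub>v x) ` level a \<subseteq> level a"
    using O_D[OF g] by (auto simp: level_def)
  moreover have "finite (level a)" by (simp add: level_def)
  ultimately show ?thesis by (simp add: bij_betw_def endo_inj_surj)
qed

definition level_sign :: "'k \<Rightarrow> 'k mat \<Rightarrow> int" where
  "level_sign a g = sign_on (level a) (\<lambda>x. g *\<^sub>v x)"

lemma level_sign_mult:
  assumes "g \<in> OQ" "h \<in> OQ"
  shows "level_sign a (g * h) = level_sign a g * level_sign a h"
proof -
  have "level_sign a (g * h) = sign_on (level a) ((\<lambda>x. g *\<^sub>v x) \<circ> (\<lambda>x. h *\<^sub>v x))"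
    unfolding level_sign_def by (rule sign_on_cong) (use assms in \<open>auto simp: level_def O_mult_apply\<close>)
  then show ?thesis unfolding level_sign_def
    using sign_on_compose[OF O_bij_level O_bij_level, OF assms, of a] by (simp add: level_def)
qed

text \<open>The group \<open>{\<plusminus>1, \<plusminus>r\<^sub>v}\<close> acts freely on the vectors of the level set moved by \<open>r\<^sub>v\<close>,
  except for those on the line through \<open>v\<close>, of which there are none or two.\<close>

lemma level_sign_refl:
  assumes v: "v \<in> V" "Q v \<noteq> 0" and a: "a \<noteq> 0"
  shows "level_sign a (refl_mat v) = (if Q v / a \<in> unit_squares then -1 else 1)"
proof -
  let ?f = "\<lambda>x. refl_mat v *\<^sub>v x" and ?g = "\<lambda>x :: 'k vec. (-1) \<cdot>\<^sub>v x"
  define Mv where "Mv = {x \<in> level a. ?f x \<noteq> x}"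
  \<comment> \<open>On \<open>S\<close> the four-group acts freely; on \<open>T\<close> the
    reflection acts as -1.\<close>
  define S where "S = {x \<in> Mv. ?f x \<noteq> ?g x}"
  define T where "T = {x \<in> Mv. ?f x = ?g x}"
  have fin: "finite (level a)" by (simp add: level_def)
  have f_level: "?f x \<in> level a" "?f (?f x) = x" if "x \<in> level a" for x
    using that v O_D[OF refl_O[OF v]] by (auto simp: level_def refl_refl)
  obtain k where k: "card Mv = 2 * k" "level_sign a (refl_mat v) = (-1) ^ k"
    using sign_on_involution[OF fin, of ?f] f_level unfolding level_sign_def Mv_def by blast
  have Mv_eq: "Mv = {x \<in> V. Q x = a \<and> bil x v \<noteq> 0}"
    using v by (auto simp: Mv_def level_def refl_fix_iff)
  have nz: "x \<noteq> ?g x" if x: "x \<in> V" "Q x = a" for x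
  proof
    assume "x = ?g x"
    then have "bil x x = bil (?g x) x" by simp
    then have "bil x x = - bil x x" using x by (simp add: bil_smult_left)
    then have "2 * (2 * Q x) = 0" by (simp only: bil_self eq_neg_iff_add_eq_0 mult_2)
    then show False using a x two by (metis mult_eq_0_iff)
  qed
  have fg: "?f (?g x) = ?g (?f x)" if "x \<in> V" for x
    using that v by (simp add: mult_mat_vec[OF refl_carrier])
  have gg: "?g (?g x) = x" if "x \<in> V" for x using that by (intro eq_vecI) auto
  have bilf: "bil (?f x) v = - bil x v" if "x \<in> V" for x
    using that v by (simp add: refl_apply bil_simps bil_self)
  have ginj: "x = y" if "?g x = ?g y" "x \<in> V" "y \<in> V" for x y using that gg by metis
  have S_iff: "x \<in> S \<longleftrightarrow> x \<in> V \<and> Q x = a \<and> bil x v \<noteq> 0 \<and> ?f x \<noteq> ?g x" for x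
    by (auto simp: S_def Mv_eq)
  have "4 dvd card S"
  proof (rule four_dvd_card_commuting_involutions[where f="?f" and g="?g"])
    show "finite S" using fin by (auto simp: S_def Mv_def)
    fix x assume "x \<in> S"
    then have x: "x \<in> V" "Q x = a" "bil x v \<noteq> 0" "?f x \<noteq> ?g x" by (auto simp: S_iff)
    have fx: "?f x \<in> V" "Q (?f x) = a" using f_level[of x] x by (auto simp: level_def)
    have "?f (?f x) \<noteq> ?g (?f x)"
      using x fx f_level(2)[of x] gg[of "?f x"] by (auto simp: level_def)
    then show "?f x \<in> S" using x fx bilf[of x] by (simp add: S_iff)
    have "?f (?g x) \<noteq> ?g (?g x)" using fg[OF x(1)] x fx ginj[of "?f x" "?g x"] by auto
    then show "?g x \<in> S" using x v by (simp add: S_iff Q_smult bil_smult_left)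
    show "?f (?f x) = x" using v x by (simp add: refl_refl)
    show "?g (?g x) = x" by (rule gg[OF x(1)])
    show "?f (?g x) = ?g (?f x)" by (rule fg[OF x(1)])
    show "?f x \<noteq> x" using x v by (simp add: refl_fix_iff)
    show "?g x \<noteq> x" using nz x by metis
    show "?f x \<noteq> ?g x" by (rule x(4))
  qed
  moreover have "card Mv = card S + card T"
  proof -
    have "Mv = S \<union> T" "S \<inter> T = {}" by (auto simp: S_def T_def)
    moreover have "finite S" "finite T" using fin by (auto simp: S_def T_def Mv_def)
    ultimately show ?thesis by (simp add: card_Un_disjoint)
  qed
  moreover have "card T = (if Q v / a \<in> unit_squares then 2 else 0)"
  proof -
    have T_iff: "x \<in> T \<longleftrightarrow> (\<exists>c. x = c \<cdot>\<^sub>v v \<and> c * c * Q v = a)" for x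
    proof
      assume "x \<in> T"
      then have x: "x \<in> V" "Q x = a" "?f x = ?g x" by (auto simp: T_def Mv_eq)
      \<comment> \<open>If the reflection negates \<open>x\<close>, its formula says that
        \<open>2 x\<close> is \<open>bil x v / Q v\<close> times \<open>v\<close>.\<close>
      define c where "c = bil x v / (2 * Q v)"
      have "x = c \<cdot>\<^sub>v v"
      proof (rule eq_vecI)
        fix i assume "i < dim_vec (c \<cdot>\<^sub>v v)"
        then have i: "i < n" using v by simp
        have "x $ i - bil x v / Q v * v $ i = - x $ i"
          using arg_cong[OF x(3), of "\<lambda>z. z $ i"] x(1) v i by (simp add: refl_apply)
        then have "2 * x $ i = bil x v / Q v * v $ i" by (simp add: algebra_simps)
        then have "x $ i = (bil x v / Q v * v $ i) / 2" using two by (metis nonzero_mult_div_cancel_left)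
        then show "x $ i = (c \<cdot>\<^sub>v v) $ i" using i v two by (simp add: c_def field_simps)
      qed (use x v in simp)
      then show "\<exists>c. x = c \<cdot>\<^sub>v v \<and> c * c * Q v = a" using x(2) Q_smult[OF v(1)] by auto
    next
      assume "\<exists>c. x = c \<cdot>\<^sub>v v \<and> c * c * Q v = a"
      then obtain c where c: "x = c \<cdot>\<^sub>v v" "c * c * Q v = a" by auto
      have "c \<noteq> 0" using c a by auto
      moreover have "?f x = ?g x"
        unfolding c(1) using v by (intro eq_vecI) (auto simp: refl_apply bil_simps bil_self)
      ultimately show "x \<in> T" using c v two by (simp add: T_def Mv_eq Q_smult bil_simps bil_self)
    qed
    show ?thesis
    proof (cases "Q v / a \<in> unit_squares")
      case True
      then obtain s where s: "s \<noteq> 0" "Q v / a = s * s" by (auto simp: unit_squares_iff)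
      define c where "c = inverse s"
      have c: "c \<noteq> 0" "c * c * Q v = a"
        using s a by (auto simp: c_def field_simps)
      have "T = {c \<cdot>\<^sub>v v, (- c) \<cdot>\<^sub>v v}"
      proof (rule Set.set_eqI)
        fix x
        have "b * b * Q v = a \<longleftrightarrow> b = c \<or> b = - c" for b
          unfolding c(2)[symmetric] using v(2) by (simp add: square_eq_iff)
        then show "x \<in> T \<longleftrightarrow> x \<in> {c \<cdot>\<^sub>v v, (- c) \<cdot>\<^sub>v v}" unfolding T_iff by auto
      qed
      moreover have "c \<cdot>\<^sub>v v \<noteq> (- c) \<cdot>\<^sub>v v"
        using nz[of "c \<cdot>\<^sub>v v"] c v by (auto simp: Q_smult smult_smult_assoc)
      ultimately show ?thesis using True by simp
    next
      case False
      have "T = {}"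
      proof (rule ccontr)
        assume "T \<noteq> {}"
        then obtain c where c: "c * c * Q v = a" using T_iff by blast
        then have "c \<noteq> 0" using a by auto
        then have "Q v / a = inverse c * inverse c" "inverse c \<noteq> 0"
          using v(2) by (auto simp: c[symmetric] field_simps)
        then show False using False unit_squares_iff by blast
      qed
      then show ?thesis using False by simp
    qed
  qed
  \<comment> \<open>Half of \<open>card S\<close> is even, so the parity of the number
    \<open>k\<close> of transpositions is decided by \<open>T\<close>, which contributes one or
    none.\<close>
  ultimately have *: "2 * k = card S + (if Q v / a \<in> unit_squares then 2 else 0)" "4 dvd card S"
    using k(1) by simp_all
  then obtain r where "card S = 4 * r" by blast
  then have "k = 2 * r + (if Q v / a \<in> unit_squares then 1 else 0)" using *(1) by (auto split: if_splits)
  then show ?thesis unfolding k(2) by simp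
qed

text \<open>It ensures that the choice in \<open>spinor_norm\<close> yields a homomorphism with the
  required values on reflections.\<close>

lemma spinor_norm_exists:
  "\<exists>sp. sp \<in> hom (orthogonal_group n Q) square_classes \<and>
    (\<forall>v \<in> V. Q v \<noteq> 0 \<longrightarrow>
      (\<forall>r \<in> OQ. (\<forall>w \<in> V. r *\<^sub>v w = reflection Q v w) \<longrightarrow> sp r = square_class (- Q v)))"
proof -
  obtain e :: 'k where e: "e \<noteq> 0" "e \<notin> unit_squares" using nonsquare_exists[OF two] by blast
  \<comment> \<open>This gives \<open>- Q v = (Q v / a) * e\<close>. Hence the reflections with sign
    -1 are those with \<open>- Q v\<close> in the class of \<open>e\<close>, and the sign -1 is sent
    to that class.\<close>
  define a where "a = - e"
  have a: "a \<noteq> 0" using e by (simp add: a_def)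
  define sp where "sp g = square_class (if level_sign a g = 1 then 1 else e)" for g
  have pm: "level_sign a g = 1 \<or> level_sign a g = -1" for g
    unfolding level_sign_def sign_on_def by (metis sign_cases)
  have ee: "e * e \<in> unit_squares" using e unit_squares_iff by blast
  have "sp \<in> hom (orthogonal_group n Q) square_classes"
  proof (rule homI)
    fix g assume "g \<in> OQ"
    show "sp g \<in> carrier square_classes" using e by (simp add: sp_def carrier_square_classes)
  next
    fix g h assume gh: "g \<in> OQ" "h \<in> OQ"
    have mult: "g \<otimes>\<^bsub>orthogonal_group n Q\<^esub> h = g * h" by (simp add: orthogonal_group_def)
    have "square_class (e * e) = square_class 1"
      using ee one_in_unit_squares square_class_eq_one_iff by metis
    then show "sp (g \<otimes>\<^bsub>orthogonal_group n Q\<^esub> h) = sp g \<otimes>\<^bsub>square_classes\<^esub> sp h"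
      unfolding mult sp_def level_sign_mult[OF gh] square_class_mult
      by (cases rule: disjE[OF pm[of g]]; cases rule: disjE[OF pm[of h]]) simp_all
  qed
  moreover have "sp r = square_class (- Q v)"
    if v: "v \<in> V" "Q v \<noteq> 0" and r: "\<forall>w \<in> V. r *\<^sub>v w = reflection Q v w" for v r
  proof -
    have "level_sign a r = level_sign a (refl_mat v)"
      unfolding level_sign_def
      by (rule sign_on_cong) (use v r in \<open>auto simp: level_def refl_reflection\<close>)
    then have sgn: "level_sign a r = (if Q v / a \<in> unit_squares then -1 else 1)"
      using level_sign_refl[OF v a] by simp
    have eq: "- Q v = (Q v / a) * e" using a by (simp add: a_def field_simps)
    show ?thesis
    proof (cases "Q v / a \<in> unit_squares")
      case True
      then show ?thesis using sgn square_class_eqI[OF True eq] by (simp add: sp_def)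
    next
      case False
      then have "- Q v \<in> unit_squares"
        unfolding eq using e a v by (intro nonsquare_mult) auto
      then have "square_class 1 = square_class (- Q v)"
        using one_in_unit_squares square_class_eq_one_iff by metis
      then show ?thesis using sgn False by (simp add: sp_def)
    qed
  qed
  ultimately show ?thesis by blast
qed

abbreviation spinor_trivial :: "'k mat \<Rightarrow> bool" where
  "spinor_trivial g \<equiv> spinor_norm n Q g = \<one>\<^bsub>square_classes\<^esub>"

lemma spinor_norm_hom: "spinor_norm n Q \<in> hom (orthogonal_group n Q) square_classes"
  unfolding spinor_norm_def by (rule conjunct1[OF someI_ex[OF spinor_norm_exists]])

lemma spinor_norm_refl: 
  assumes "v \<in> V" "Q v \<noteq> 0"
  shows "spinor_norm n Q (refl_mat v) = square_class (- Q v)"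
  using conjunct2[OF someI_ex[OF spinor_norm_exists]] assms refl_O[OF assms] refl_reflection
  unfolding spinor_norm_def by blast

lemma spinor_norm_mult:
  "g \<in> OQ \<Longrightarrow> h \<in> OQ \<Longrightarrow>
    spinor_norm n Q (g * h) = spinor_norm n Q g \<otimes>\<^bsub>square_classes\<^esub> spinor_norm n Q h"
  using hom_mult[OF spinor_norm_hom] by (simp add: orthogonal_group_def)

lemma spinor_trivial_mult_iff:
  assumes "g \<in> OQ" "h \<in> OQ" "\<not> spinor_trivial h"
  shows "spinor_trivial (h * g) \<longleftrightarrow> \<not> spinor_trivial g"
  using assms square_classes_mult_nontrivial spinor_norm_mult[of h g]
    hom_in_carrier[OF spinor_norm_hom] by metis

subsection \<open>The determinant\<close>

text \<open>\<open>det_of_asymmetry\<close> applies to \<open>A = M * (g - 1\<^sub>m n)\<close>,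
  which has the kernel of \<open>g - 1\<^sub>m n\<close> because \<open>M\<close> is
  invertible.\<close>

lemma det_orthogonal:
  assumes g: "g \<in> OQ"
  shows "kernel_dim (g - 1\<^sub>m n) \<le> n" "det g = (-1) ^ (n - kernel_dim (g - 1\<^sub>m n))"
proof -
  have gc: "g \<in> carrier_mat n n" by (rule O_D(1)[OF g])
  let ?N = "g - 1\<^sub>m n" and ?gT = "transpose_mat g"
  have N: "?N \<in> carrier_mat n n" by (rule minus_carrier_mat) simp
  have MN: "M * ?N \<in> carrier_mat n n" using M N by simp
  have gMg: "?gT * M * g = M"
  proof (rule eq_mat_if_vecs_eq[of _ n n])
    fix y assume y: "y \<in> V"
    show "?gT * M * g *\<^sub>v y = M *\<^sub>v y"
    proof (rule eq_vec_if_scalar_prods_eq[of _ n])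
      fix x assume x: "x \<in> V"
      have "x \<bullet> (?gT * M * g *\<^sub>v y) = x \<bullet> (?gT *\<^sub>v (M *\<^sub>v (g *\<^sub>v y)))"
        using gc M y by (simp add: assoc_mult_mat_vec[of _ n n _ n])
      also have "\<dots> = (g *\<^sub>v x) \<bullet> (M *\<^sub>v (g *\<^sub>v y))"
      proof -
        have w: "M *\<^sub>v (g *\<^sub>v y) \<in> V" using gc M y by simp
        show ?thesis
          using transpose_vec_mult_scalar[OF gc x w] comm_scalar_prod[of _ n] gc x w
          by (metis mult_mat_vec_carrier transpose_carrier_mat)
      qed
      also have "\<dots> = x \<bullet> (M *\<^sub>v y)"
        using bil_preserved[OF O_D(1,3)[OF g] x y] by (simp add: bil_def)
      finally show "x \<bullet> (?gT * M * g *\<^sub>v y) = x \<bullet> (M *\<^sub>v y)" .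
    qed (use gc M y in \<open>auto intro!: mult_mat_vec_carrier[of _ n n] mult_carrier_mat[of _ n n]\<close>)
  qed (use gc M in \<open>auto intro!: mult_carrier_mat[of _ n n]\<close>)
  \<comment> \<open>Since \<open>?gT * M * g = M\<close>, the left side expands to
    \<open>M - M * g\<close>.\<close>
  have "transpose_mat (M * ?N) * g = - (M * ?N)"
  proof -
    have "transpose_mat (M * ?N) = transpose_mat ?N * M"
      using M N sym by (simp add: transpose_mult[of _ n n _ n])
    also have "transpose_mat ?N = ?gT - 1\<^sub>m n"
      using gc by (simp add: transpose_minus[of _ n n])
    also have "(?gT - 1\<^sub>m n) * M = ?gT * M - M"
      using gc M by (simp add: minus_mult_distrib_mat[of _ n n])
    also have "(?gT * M - M) * g = ?gT * M * g - M * g"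
      using gc M by (simp add: minus_mult_distrib_mat[of _ n n _ _ n])
    also have "\<dots> = M - M * g" by (simp add: gMg)
    also have "\<dots> = - (M * ?N)"
      using gc M by (subst mult_minus_distrib_mat[of _ n n _ n]) auto
    finally show ?thesis using gc M N by simp
  qed
  moreover have ker: "mat_kernel (M * ?N) = mat_kernel ?N"
    using det_nonzero_inverse[OF M nondeg] mat_kernel_mult_eq[OF N M] by metis
  moreover have "g *\<^sub>v x = x" if x: "x \<in> V" "(M * ?N) *\<^sub>v x = 0\<^sub>v n" for x
  proof -
    have "x \<in> mat_kernel ?N" using mat_kernelI[OF MN x] ker by simp
    then have "?N *\<^sub>v x = 0\<^sub>v n" using mat_kernelD[OF N] by blast
    then have "g *\<^sub>v x - x = 0\<^sub>v n" using gc x by (simp add: minus_mult_distrib_mat_vec[of _ n n])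
    then show ?thesis using minus_vec_eq_zeroD O_D(2)[OF g x(1)] x(1) by blast
  qed
  ultimately obtain k where k: "k \<le> n" "card (mat_kernel ?N) = CARD('k) ^ k" "det g = (-1) ^ (n - k)"
    using det_of_asymmetry[OF MN gc] by metis
  have "card {0, 1 :: 'k} \<le> CARD('k)" by (rule card_mono) auto
  then have "k = kernel_dim ?N"
    using k(2) card_mat_kernel[OF N] power_inject_exp[of "CARD('k)"] by simp
  then show "kernel_dim ?N \<le> n" "det g = (-1) ^ (n - kernel_dim ?N)" using k by auto
qed

subsection \<open>Fixed vectors and spinor classes\<close>

lemma CARD_gt_1: "1 < CARD('k)"
proof -
  have "card {0, 1 :: 'k} \<le> CARD('k)" by (rule card_mono) auto
  then show ?thesis by simp
qed

lemma fixed_vectors_eq_kernel: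
  assumes "g \<in> carrier_mat n n"
  shows "{x \<in> V. g *\<^sub>v x = x} = mat_kernel (g - 1\<^sub>m n)"
proof -
  have N: "g - 1\<^sub>m n \<in> carrier_mat n n" by (rule minus_carrier_mat) simp
  have "(g - 1\<^sub>m n) *\<^sub>v x = 0\<^sub>v n \<longleftrightarrow> g *\<^sub>v x = x" if "x \<in> V" for x
  proof -
    have "(g - 1\<^sub>m n) *\<^sub>v x = g *\<^sub>v x - x"
      using assms that by (simp add: minus_mult_distrib_mat_vec[of _ n n])
    moreover have "g *\<^sub>v x \<in> V" using assms that by simp
    ultimately show ?thesis using minus_vec_eq_zeroD[of "g *\<^sub>v x" n x] that by auto
  qed
  then show ?thesis unfolding mat_kernel[OF N] by auto
qed

lemma card_fixed_vectors:
  assumes "g \<in> carrier_mat n n"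
  shows "card {x \<in> V. g *\<^sub>v x = x} = CARD('k) ^ kernel_dim (g - 1\<^sub>m n)"
  unfolding fixed_vectors_eq_kernel[OF assms]
  by (rule card_mat_kernel[of _ n n]) (rule minus_carrier_mat, simp)

text \<open>The fixed space is the hyperplane orthogonal to \<open>v\<close>, of codimension one, so
  \<open>det_orthogonal\<close> gives the sign.\<close>

lemma det_refl:
  assumes v: "v \<in> V" "Q v \<noteq> 0"
  shows "det (refl_mat v) = -1"
proof -
  let ?k = "kernel_dim (refl_mat v - 1\<^sub>m n)" and ?q = "CARD('k)"
  have ne: "\<exists>u\<in>V. bil u v \<noteq> 0" using v two by (intro bexI[of _ v]) (auto simp: bil_self)
  have "{x \<in> V. refl_mat v *\<^sub>v x = x} = {x \<in> V. bil x v = 0}"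
    using refl_fix_iff[OF v(1) _ v(2)] by auto
  then have card: "card {x \<in> V. bil x v = 0} = ?q ^ ?k"
    using card_fixed_vectors[OF refl_carrier, of v] by simp
  have "card V = (\<Sum>c\<in>(UNIV :: 'k set). ?q ^ ?k)"
    unfolding card_subspace_level_sets[OF subspace_V, of v] card[symmetric]
    by (intro sum.cong refl card_level_set[OF subspace_V v(1) ne])
  then have "?q ^ n = ?q ^ Suc ?k" by (simp add: card_carrier_vec)
  then have "n = Suc ?k" using CARD_gt_1 power_inject_exp by blast
  then have "n - ?k = 1" by simp
  then show ?thesis using det_orthogonal(2)[OF refl_O[OF v]] by simp
qed

lemma finite_O: "finite OQ"
proof (rule finite_imageD)
  let ?F = "\<lambda>g. restrict (\<lambda>x. g *\<^sub>v x) V"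
  have "?F ` OQ \<subseteq> V \<rightarrow>\<^sub>E V" using O_D(2) by fastforce
  then show "finite (?F ` OQ)" by (rule finite_subset) (simp add: finite_PiE)
  show "inj_on ?F OQ"
  proof (rule inj_onI)
    fix g h assume gh: "g \<in> OQ" "h \<in> OQ" "?F g = ?F h"
    have "g *\<^sub>v x = h *\<^sub>v x" if "x \<in> V" for x using fun_cong[OF gh(3), of x] that by simp
    then show "g = h" using eq_mat_if_vecs_eq O_D(1) gh by blast
  qed
qed

text \<open>The product of the reflections in two vectors of \<open>perp S\<close> fixes
  \<open>S\<close> pointwise and has determinant 1. As \<open>Q\<close> takes all values on
  \<open>perp S\<close>, their spinor norms can be prescribed.\<close>

lemma rotation_fixing_with_nontrivial_spinor_norm:
  assumes S: "finite S" "S \<subseteq> V" and n: "2 * card S + 2 \<le> n"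
  shows "\<exists>h\<in>OQ. \<exists>h'\<in>OQ. h * h' = 1\<^sub>m n \<and> h' * h = 1\<^sub>m n \<and> det h = 1 \<and> \<not> spinor_trivial h \<and>
    (\<forall>x\<in>S. h *\<^sub>v x = x \<and> h' *\<^sub>v x = x)"
proof -
  obtain e :: 'k where e: "e \<noteq> 0" "e \<notin> unit_squares" using nonsquare_exists[OF two] by blast
  \<comment> \<open>The reflections in \<open>u\<close> and \<open>v\<close> have the spinor norms
    of \<open>1\<close> and \<open>e\<close>.\<close>
  obtain u v where u: "u \<in> perp S" "Q u = -1" and v: "v \<in> perp S" "Q v = - e"
    using Q_surj_on_perp[OF assms] by metis
  have uV: "u \<in> V" "Q u \<noteq> 0" and vV: "v \<in> V" "Q v \<noteq> 0" using u v e by (auto simp: perp_def)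
  note uO = refl_O[OF uV] and vO = refl_O[OF vV]
  have fix_u: "refl_mat u *\<^sub>v x = x" and fix_v: "refl_mat v *\<^sub>v x = x" if "x \<in> S" for x
    using that u v S(2) by (auto simp: perp_def subset_iff intro!: refl_fix)
  have cancel: "(refl_mat x * refl_mat y) * (refl_mat y * refl_mat x) = 1\<^sub>m n"
    if x: "x \<in> V" "Q x \<noteq> 0" and y: "y \<in> V" "Q y \<noteq> 0" for x y
  proof -
    have "(refl_mat x * refl_mat y) * (refl_mat y * refl_mat x) = refl_mat x * (refl_mat y * refl_mat y) * refl_mat x"
      using refl_carrier[of x] refl_carrier[of y] by (simp add: assoc_mult_mat[of _ n n _ n _ n])
    then show ?thesis using refl_mult_self x y refl_carrier[of x] by simp
  qed
  show ?thesis
  proof (rule bexI[of _ "refl_mat v * refl_mat u"], rule bexI[of _ "refl_mat u * refl_mat v"], intro conjI ballI)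
    show "det (refl_mat v * refl_mat u) = 1"
      using det_refl uV vV by (simp add: det_mult[OF refl_carrier refl_carrier])
    have "spinor_trivial (refl_mat u)"
      using spinor_norm_refl[OF uV] u(2) one_in_unit_squares square_class_eq_one_iff by force
    moreover have "\<not> spinor_trivial (refl_mat v)"
      using spinor_norm_refl[OF vV] v(2) e square_class_eq_one_iff by force
    ultimately show "\<not> spinor_trivial (refl_mat v * refl_mat u)"
      using spinor_trivial_mult_iff[OF uO vO] by blast
  qed (use cancel uV vV uO vO O_mult O_mult_apply fix_u fix_v S(2) in \<open>auto simp: subset_iff\<close>)
qed

text \<open>A common indexing of the four cosets, so that one argument serves both
  determinants.\<close>

definition spinor_part :: "bool \<Rightarrow> bool \<Rightarrow> 'k mat set" where
  "spinor_part b c = {g \<in> OQ. (det g = 1) = b \<and> spinor_trivial g = c}"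

lemma finite_spinor_part: "finite (spinor_part b c)"
  using finite_O by (simp add: spinor_part_def)

text \<open>Left multiplication by a rotation that fixes \<open>S\<close> pointwise and has
  nontrivial spinor norm exchanges the two sets.\<close>

lemma card_spinor_part_stabilizer:
  assumes S: "finite S" "S \<subseteq> V" and n: "2 * card S + 2 \<le> n"
  shows "card {g \<in> spinor_part b True. \<forall>x\<in>S. g *\<^sub>v x = x} =
    card {g \<in> spinor_part b False. \<forall>x\<in>S. g *\<^sub>v x = x}"
proof -
  obtain h h' where h: "h \<in> OQ" "h' \<in> OQ" "h * h' = 1\<^sub>m n" "h' * h = 1\<^sub>m n" "det h = 1"
    "\<not> spinor_trivial h" and fixed: "\<And>x. x \<in> S \<Longrightarrow> h *\<^sub>v x = x" "\<And>x. x \<in> S \<Longrightarrow> h' *\<^sub>v x = x"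
    using rotation_fixing_with_nontrivial_spinor_norm[OF assms] by blast
  note c = O_D(1)[OF h(1)] O_D(1)[OF h(2)]
  have "det h * det h' = 1" using det_mult[OF c] h(3) by simp
  then have det': "det h' = 1" using h(5) by simp
  have "spinor_trivial (h * h')  \<longleftrightarrow> \<not> spinor_trivial h'"
    by (rule spinor_trivial_mult_iff[OF h(2,1,6)])
  moreover have "spinor_trivial (1\<^sub>m n)"
  proof (rule ccontr)
    assume nt: "\<not> spinor_trivial (1\<^sub>m n)"
    have "1\<^sub>m n \<in> OQ" by (rule O_I) auto
    then show False using spinor_trivial_mult_iff[of "1\<^sub>m n" "1\<^sub>m n"] nt by simp
  qed
  ultimately have h'6: "\<not> spinor_trivial h'" using h(3) by simp
  have move: "k * g \<in> {g \<in> spinor_part b (\<not> c). \<forall>x\<in>S. g *\<^sub>v x = x}"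
    if k: "k \<in> OQ" "det k = 1" "\<not> spinor_trivial k" "\<And>x. x \<in> S \<Longrightarrow> k *\<^sub>v x = x"
      and g: "g \<in> {g \<in> spinor_part b c. \<forall>x\<in>S. g *\<^sub>v x = x}" for k g c
  proof -
    have gO: "g \<in> OQ" "(det g = 1) = b" "spinor_trivial g = c" "\<And>x. x \<in> S \<Longrightarrow> g *\<^sub>v x = x"
      using g by (auto simp: spinor_part_def)
    have "det (k * g) = det g" using det_mult[OF O_D(1)[OF k(1)] O_D(1)[OF gO(1)]] k(2) by simp
    moreover have "(k * g) *\<^sub>v x = x" if "x \<in> S" for x
      using that S(2) O_mult_apply[OF k(1) gO(1)] k(4) gO(4) by auto
    ultimately show ?thesis
      using O_mult[OF k(1) gO(1)] spinor_trivial_mult_iff[OF gO(1) k(1,3)] gO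
      by (simp add: spinor_part_def)
  qed
  have cancel: "k * (k' * g) = g" if "k \<in> OQ" "k' \<in> OQ" "k * k' = 1\<^sub>m n" "g \<in> OQ" for k k' g
    using that O_D(1)[OF that(1)] O_D(1)[OF that(2)] O_D(1)[OF that(4)]
    by (simp add: assoc_mult_mat[of k n n k' n g n, symmetric])
  have "bij_betw (\<lambda>g. h * g) {g \<in> spinor_part b True. \<forall>x\<in>S. g *\<^sub>v x = x}
      {g \<in> spinor_part b False. \<forall>x\<in>S. g *\<^sub>v x = x}"
  proof (rule bij_betw_byWitness[where f'="\<lambda>g. h' * g"])
    show "(\<lambda>g. h * g) ` {g \<in> spinor_part b True. \<forall>x\<in>S. g *\<^sub>v x = x}
        \<subseteq> {g \<in> spinor_part b False. \<forall>x\<in>S. g *\<^sub>v x = x}"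
      using move[OF h(1,5,6) fixed(1), where c=True] by auto
    show "(\<lambda>g. h' * g) ` {g \<in> spinor_part b False. \<forall>x\<in>S. g *\<^sub>v x = x}
        \<subseteq> {g \<in> spinor_part b True. \<forall>x\<in>S. g *\<^sub>v x = x}"
      using move[OF h(2) det' h'6 fixed(2), where c=False] by auto
  qed (use cancel h in \<open>auto simp: spinor_part_def\<close>)
  then show ?thesis by (rule bij_betw_same_card)
qed

text \<open>The \<open>j\<close>-th power of the number of fixed vectors counts the fixed \<open>j\<close>-tuples.\<close>

lemma sum_fixed_tuples:
  assumes n: "2 * j + 2 \<le> n"
  shows "(\<Sum>g\<in>spinor_part b True. (CARD('k) ^ kernel_dim (g - 1\<^sub>m n)) ^ j) =
    (\<Sum>g\<in>spinor_part b False. (CARD('k) ^ kernel_dim (g - 1\<^sub>m n)) ^ j)"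
proof -
  let ?T = "{..<j} \<rightarrow>\<^sub>E V"
  let ?fix = "\<lambda>g x. \<forall>i<j. g *\<^sub>v x i = x i"
  have fin: "finite ?T" by (simp add: finite_PiE)
  have *: "(\<Sum>g\<in>spinor_part b c. (CARD('k) ^ kernel_dim (g - 1\<^sub>m n)) ^ j) =
      (\<Sum>x\<in>?T. card {g \<in> spinor_part b c. ?fix g x})" for c
  proof -
    have "(CARD('k) ^ kernel_dim (g - 1\<^sub>m n)) ^ j = (\<Sum>x\<in>?T. of_bool (?fix g x))"
      if "g \<in> spinor_part b c" for g
    proof -
      have "g \<in> carrier_mat n n" using that O_D(1) by (simp add: spinor_part_def)
      then have "(CARD('k) ^ kernel_dim (g - 1\<^sub>m n)) ^ j = card ({..<j} \<rightarrow>\<^sub>E {x \<in> V. g *\<^sub>v x = x})"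
        by (simp add: card_PiE card_fixed_vectors)
      also have "{..<j} \<rightarrow>\<^sub>E {x \<in> V. g *\<^sub>v x = x} = ?T \<inter> {x. ?fix g x}"
        by (auto simp: PiE_iff)
      also have "card \<dots> = (\<Sum>x\<in>?T. of_bool (?fix g x))" using fin by simp
      finally show ?thesis .
    qed
    then have "(\<Sum>g\<in>spinor_part b c. (CARD('k) ^ kernel_dim (g - 1\<^sub>m n)) ^ j) =
        (\<Sum>g\<in>spinor_part b c. \<Sum>x\<in>?T. of_bool (?fix g x))" by (intro sum.cong refl)
    also have "\<dots> = (\<Sum>x\<in>?T. \<Sum>g\<in>spinor_part b c. of_bool (?fix g x))" by (rule sum.swap)
    also have "\<dots> = (\<Sum>x\<in>?T. card {g \<in> spinor_part b c. ?fix g x})"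
      using finite_spinor_part by (intro sum.cong refl) (simp add: Int_def)
    finally show ?thesis .
  qed
  \<comment> \<open>Fixing a tuple means fixing its set of entries, which has at most
    \<open>j\<close> elements.\<close>
  have "card {g \<in> spinor_part b True. ?fix g x} = card {g \<in> spinor_part b False. ?fix g x}"
    if "x \<in> ?T" for x
  proof -
    have "card (x ` {..<j}) \<le> j" using card_image_le[of "{..<j}" x] by simp
    then have "2 * card (x ` {..<j}) + 2 \<le> n" using n by simp
    moreover have "x ` {..<j} \<subseteq> V" using that by auto
    moreover have "{g \<in> spinor_part b c. \<forall>y\<in>x ` {..<j}. g *\<^sub>v y = y} = {g \<in> spinor_part b c. ?fix g x}" for c
      by auto
    ultimately show ?thesis using card_spinor_part_stabilizer[of "x ` {..<j}" b] by simp
  qed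
  then show ?thesis unfolding * by (intro sum.cong refl)
qed

section \<open>The difference of the coset sums as a polynomial\<close>

definition diff_poly :: "bool \<Rightarrow> rat poly" where
  "diff_poly b = (\<Sum>g\<in>spinor_part b True. Polynomial.monom 1 (kernel_dim (g - 1\<^sub>m n))) -
    (\<Sum>g\<in>spinor_part b False. Polynomial.monom 1 (kernel_dim (g - 1\<^sub>m n)))"

lemma poly_diff_poly:
  "poly (diff_poly b) t = (\<Sum>g\<in>spinor_part b True. t ^ kernel_dim (g - 1\<^sub>m n)) -
    (\<Sum>g\<in>spinor_part b False. t ^ kernel_dim (g - 1\<^sub>m n))"
  by (simp add: diff_poly_def poly_sum poly_monom)

text \<open>At \<open>t = q ^ j\<close> the term \<open>t ^ k\<close> equals
  \<open>(q ^ k) ^ j\<close>, so \<open>sum_fixed_tuples\<close> makes the two sums equal.\<close>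

lemma diff_poly_root:
  assumes "2 * j + 2 \<le> n"
  shows "poly (diff_poly b) (of_nat CARD('k) ^ j) = 0"
proof -
  have eq: "(of_nat CARD('k) ^ j) ^ k = (of_nat ((CARD('k) ^ k) ^ j) :: rat)" for k
    by (simp add: power_mult[symmetric] mult.commute)
  show ?thesis
    unfolding poly_diff_poly eq of_nat_sum[symmetric] sum_fixed_tuples[OF assms] by simp
qed

text \<open>By \<open>det_orthogonal\<close> the determinant records the parity of the codimension
  of the fixed space, and \<open>n\<close> is even.\<close>

lemma even_kernel_dim_iff:
  assumes "even n" "g \<in> spinor_part b c"
  shows "even (kernel_dim (g - 1\<^sub>m n)) \<longleftrightarrow> b"
proof -
  have g: "g \<in> OQ" "(det g = 1) = b" using assms(2) by (auto simp: spinor_part_def)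
  have "(-1 :: 'k) \<noteq> 1" using two by (metis add.right_inverse one_add_one)
  then have "det g = 1 \<longleftrightarrow> even (n - kernel_dim (g - 1\<^sub>m n))"
    unfolding det_orthogonal(2)[OF g(1)] by (cases "even (n - kernel_dim (g - 1\<^sub>m n))") auto
  then show ?thesis using det_orthogonal(1)[OF g(1)] assms(1) g(2) by simp
qed

text \<open>All exponents have the parity that \<open>b\<close> dictates, so the polynomial is even
  or odd.\<close>

lemma diff_poly_minus:
  assumes "even n"
  shows "poly (diff_poly b) (- t) = (if b then 1 else -1) * poly (diff_poly b) t"
proof -
  have "(\<Sum>g\<in>spinor_part b c. (- t) ^ kernel_dim (g - 1\<^sub>m n)) =
      (if b then 1 else -1) * (\<Sum>g\<in>spinor_part b c. t ^ kernel_dim (g - 1\<^sub>m n))" for c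
    unfolding sum_distrib_left
    by (intro sum.cong refl) (auto simp: even_kernel_dim_iff[OF assms] power_minus')
  then show ?thesis unfolding poly_diff_poly by (simp add: right_diff_distrib)
qed

lemma degree_diff_poly: "degree (diff_poly b) \<le> n"
proof -
  have "kernel_dim (g - 1\<^sub>m n) \<le> n" if "g \<in> spinor_part b c" for g c
    using that det_orthogonal(1) by (simp add: spinor_part_def)
  then show ?thesis unfolding diff_poly_def
    by (intro degree_diff_le degree_sum_le finite_spinor_part)
       (auto intro: order_trans[OF degree_monom_le])
qed

lemma one_in_spinor_part: "1\<^sub>m n \<in> spinor_part b c \<longleftrightarrow> b \<and> c"
proof -
  have O: "1\<^sub>m n \<in> OQ" by (rule O_I) auto
  then have "spinor_trivial (1\<^sub>m n)" using spinor_trivial_mult_iff[of "1\<^sub>m n" "1\<^sub>m n"] by auto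
  then show ?thesis using O by (auto simp: spinor_part_def)
qed

lemma kernel_dim_eq_n_iff:
  assumes "g \<in> OQ"
  shows "kernel_dim (g - 1\<^sub>m n) = n \<longleftrightarrow> g = 1\<^sub>m n"
proof
  assume "kernel_dim (g - 1\<^sub>m n) = n"
  then have "card {x \<in> V. g *\<^sub>v x = x} = card V"
    using card_fixed_vectors[OF O_D(1)[OF assms]] by (simp add: card_carrier_vec)
  then have "{x \<in> V. g *\<^sub>v x = x} = V" by (intro card_subset_eq) auto
  then show "g = 1\<^sub>m n" using O_D(1)[OF assms] by (intro eq_mat_if_vecs_eq[of _ n n]) auto
next
  assume "g = 1\<^sub>m n"
  then have "{x \<in> V. g *\<^sub>v x = x} = V" by auto
  then have "CARD('k) ^ kernel_dim (g - 1\<^sub>m n) = CARD('k) ^ n"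
    using card_fixed_vectors[OF O_D(1)[OF assms]] by (simp add: card_carrier_vec)
  then show "kernel_dim (g - 1\<^sub>m n) = n" using CARD_gt_1 power_inject_exp by blast
qed

text \<open>Only the identity fixes every vector, and it has determinant 1 and trivial spinor
  norm.\<close>

lemma coeff_diff_poly: "Polynomial.coeff (diff_poly b) n = of_bool b"
proof -
  have "(\<Sum>g\<in>spinor_part b c. Polynomial.coeff (Polynomial.monom 1 (kernel_dim (g - 1\<^sub>m n))) n) =
      (of_bool (b \<and> c) :: rat)" for c
  proof -
    have "(\<Sum>g\<in>spinor_part b c. Polynomial.coeff (Polynomial.monom 1 (kernel_dim (g - 1\<^sub>m n))) n) =
        (\<Sum>g\<in>spinor_part b c. if g = 1\<^sub>m n then 1 else 0 :: rat)"
      by (intro sum.cong refl) (auto simp: spinor_part_def kernel_dim_eq_n_iff)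
    also have "\<dots> = of_bool (b \<and> c)"
      using finite_spinor_part by (simp add: one_in_spinor_part)
    finally show ?thesis .
  qed
  then show ?thesis by (simp add: diff_poly_def coeff_sum)
qed

text \<open>In the difference of the two polynomials the coefficient at \<open>n\<close> cancels,
  while the \<open>m\<close> powers of \<open>CARD('k)\<close> and their negatives are
  \<open>n\<close> distinct roots.\<close>

lemma diff_poly_eqI:
  assumes n: "n = 2 * m" and deg: "degree p \<le> n" and lead: "Polynomial.coeff p n = of_bool b"
    and roots: "\<And>j. j < m \<Longrightarrow> poly p (of_nat CARD('k) ^ j) = 0"
      "\<And>j. j < m \<Longrightarrow> poly p (- (of_nat CARD('k) ^ j)) = 0"
  shows "diff_poly b = p"
proof -
  let ?q = "of_nat CARD('k) :: rat"
  let ?R = "(\<lambda>j. ?q ^ j) ` {..<m}" and ?R' = "(\<lambda>j. - (?q ^ j)) ` {..<m}"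
  have q: "1 < ?q" using CARD_gt_1 by simp
  have "card ?R = m" "card ?R' = m"
    using q by (subst card_image; auto intro!: inj_onI simp: power_inject_exp)+
  moreover have "?R \<inter> ?R' = {}"
  proof -
    have "?q ^ i \<noteq> - (?q ^ j)" for i j
      using q zero_less_power[of ?q i] zero_less_power[of ?q j] by linarith
    then show ?thesis by auto
  qed
  ultimately have card: "card (?R \<union> ?R') = n" by (simp add: card_Un_disjoint n)
  show ?thesis
  proof (rule poly_eqI_degree_lead_coeff[of _ n _ "?R \<union> ?R'"])
    have ev: "even n" using n by simp
    fix z assume "z \<in> ?R \<union> ?R'"
    then obtain j where j: "j < m" "z = ?q ^ j \<or> z = - (?q ^ j)" by auto
    \<comment> \<open>For \<open>n = 2 * m\<close> the bound \<open>j < m\<close> is exactly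
      \<open>2 * j + 2 \<le> n\<close>.\<close>
    have "poly (diff_poly b) (?q ^ j) = 0" using j n by (intro diff_poly_root) simp
    then show "poly (diff_poly b) z = poly p z"
      using j roots[OF j(1)] diff_poly_minus[OF ev, of b "?q ^ j"] by auto
  qed (use deg lead degree_diff_poly coeff_diff_poly card in simp_all)
qed

section \<open>The generating polynomials of the four cosets\<close>

lemma dickson_eq_0_iff: "dickson (g :: 'k mat) = 0 \<longleftrightarrow> det g = 1"
  using two by (auto simp: dickson_def)

lemma cosets_eq_spinor_parts:
  "coset_Omega n Q = spinor_part True True" "coset_A n Q = spinor_part True False"
  "coset_B n Q = spinor_part False True" "coset_C n Q = spinor_part False False"
  by (auto simp: coset_Omega_def coset_A_def coset_B_def coset_C_def spinor_part_def dickson_eq_0_iff)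

theorem fix_gen_poly_cosets:
  assumes n: "n = 2 * m" and m: "m \<ge> 1"
  shows "fix_gen_poly n (coset_B n Q) = fix_gen_poly n (coset_C n Q)"
    and "fix_gen_poly n (coset_Omega n Q) = fix_gen_poly n (coset_A n Q) +
      Polynomial.smult (1 / of_nat (card (coset_Omega n Q)))
        (\<Prod>i<m. Polynomial.monom 1 2 - [:of_nat CARD('k) ^ (2 * i):])"
proof -
  \<comment> \<open>The case \<open>j = 0\<close> of the tuple count: both spinor classes have the
    same size, hence the same normalizing factor.\<close>
  have card: "card (spinor_part b True) = card (spinor_part b False)" for b
    using sum_fixed_tuples[of 0 b] n m by simp
  have diff: "fix_gen_poly n (spinor_part b True) = fix_gen_poly n (spinor_part b False) +
      Polynomial.smult (1 / of_nat (card (spinor_part b True))) (diff_poly b)" for b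
    unfolding fix_gen_poly_def diff_poly_def card by (simp add: smult_diff_right)
  \<comment> \<open>The coefficient at \<open>n\<close> is 0 here, so the zero polynomial meets all
    conditions.\<close>
  have "diff_poly False = 0" by (rule diff_poly_eqI[OF n]) auto
  then show "fix_gen_poly n (coset_B n Q) = fix_gen_poly n (coset_C n Q)"
    using diff[of False] by (simp add: cosets_eq_spinor_parts)
  let ?f = "\<lambda>i. Polynomial.monom 1 2 - [:of_nat CARD('k) ^ (2 * i):] :: rat poly"
  have f: "?f i = [:- (of_nat CARD('k) ^ (2 * i)), 0, 1:]" for i
    by (simp add: monom_altdef numeral_2_eq_2)
  have deg: "degree (\<Prod>i<m. ?f i) = n"
    by (subst degree_prod_sum_eq) (auto simp: f n)
  have "lead_coeff (\<Prod>i<m. ?f i) = 1" unfolding lead_coeff_prod by (simp add: f)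
  then have lead: "Polynomial.coeff (\<Prod>i<m. ?f i) n = 1" by (simp add: deg)
  \<comment> \<open>Each factor splits as \<open>t - q ^ i\<close> times \<open>t + q ^ i\<close>,
    so the product is monic with the prescribed roots.\<close>
  have "diff_poly True = (\<Prod>i<m. ?f i)"
  proof (rule diff_poly_eqI[OF n])
    show "poly (\<Prod>i<m. ?f i) (of_nat CARD('k) ^ j) = 0"
      "poly (\<Prod>i<m. ?f i) (- (of_nat CARD('k) ^ j)) = 0" if "j < m" for j
      using that by (auto simp: poly_prod poly_monom power_mult[symmetric] mult.commute intro!: bexI[of _ j])
  qed (use deg lead in simp_all)
  then show "fix_gen_poly n (coset_Omega n Q) = fix_gen_poly n (coset_A n Q) +
      Polynomial.smult (1 / of_nat (card (coset_Omega n Q))) (\<Prod>i<m. ?f i)"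
    using diff[of True] by (simp add: cosets_eq_spinor_parts)
qed

end

section \<open>The Gram matrix\<close>

text \<open>A unit determinant stays nonzero in every field, and the property passes to orthogonal
  sums.\<close>

definition unimodular_gram :: "int mat \<Rightarrow> bool" where
  "unimodular_gram A \<longleftrightarrow> square_mat A \<and> transpose_mat A = A \<and> is_unit (det A)"

text \<open>An explicit integral inverse certifies a unit determinant without expanding it.\<close>

lemma unimodular_gramI:
  assumes "A \<in> carrier_mat n n" "transpose_mat A = A" "B \<in> carrier_mat n n" "A * B = 1\<^sub>m n"
  shows "unimodular_gram A"
proof -
  have "det A * det B = 1" using det_mult[OF assms(1,3)] assms(4) by simp
  then have "is_unit (det A)" by (metis dvd_triv_left)
  then show ?thesis using assms by (simp add: unimodular_gram_def)
qed

lemma unimodular_diag_block_mat: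
  assumes "\<And>A. A \<in> set As \<Longrightarrow> unimodular_gram A"
  shows "unimodular_gram (diag_block_mat As)"
  using assms
proof (induction As)
  case Nil
  then show ?case by (auto simp: unimodular_gram_def det_dim_zero intro!: eq_matI)
next
  case (Cons A As)
  let ?D = "diag_block_mat As"
  obtain a where A: "A \<in> carrier_mat a a" "transpose_mat A = A" "is_unit (det A)"
    using Cons.prems[of A] by (auto simp: unimodular_gram_def)
  have "unimodular_gram ?D" using Cons by simp
  then obtain b where D: "?D \<in> carrier_mat b b" "transpose_mat ?D = ?D" "is_unit (det ?D)"
    by (auto simp: unimodular_gram_def)
  have eq: "diag_block_mat (A # As) = four_block_mat A (0\<^sub>m a b) (0\<^sub>m b a) ?D"
    using A D by (simp add: Let_def)
  have "det (diag_block_mat (A # As)) = det A * det ?D"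
    unfolding eq by (rule det_four_block_mat_upper_right_zero) (use A D in auto)
  moreover have "transpose_mat (diag_block_mat (A # As)) = diag_block_mat (A # As)"
    unfolding eq by (subst transpose_four_block_mat) (use A D in auto)
  moreover have "square_mat (diag_block_mat (A # As))"
    unfolding eq using A D by simp
  ultimately show ?case using A(3) D(3) by (simp only: unimodular_gram_def is_unit_mult_iff simp_thms)
qed

section \<open>Unimodularity of the hyperbolic plane and of the E8 lattice\<close>

lemma unimodular_hyperbolic_gram: "unimodular_gram hyperbolic_gram"
proof (rule unimodular_gramI[of _ 2 hyperbolic_gram])
  show "hyperbolic_gram * hyperbolic_gram = 1\<^sub>m 2"
    by (rule eq_matI)
       (auto simp: hyperbolic_gram_def mat_of_rows_list_def scalar_prod_def less_Suc_eq numeral_2_eq_2)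
qed (auto simp: hyperbolic_gram_def mat_of_rows_list_def less_Suc_eq numeral_2_eq_2 intro!: eq_matI)

text \<open>The entries of \<open>E8_gram\<close> as plain lists, on which the matrix identities can
  be evaluated.\<close>

definition E8_rows :: "int list list" where
  "E8_rows = [[ 2,  0, -1,  0,  0,  0,  0,  0],
     [ 0,  2,  0, -1,  0,  0,  0,  0],
     [-1,  0,  2, -1,  0,  0,  0,  0],
     [ 0, -1, -1,  2, -1,  0,  0,  0],
     [ 0,  0,  0, -1,  2, -1,  0,  0],
     [ 0,  0,  0,  0, -1,  2, -1,  0],
     [ 0,  0,  0,  0,  0, -1,  2, -1],
     [ 0,  0,  0,  0,  0,  0, -1,  2]]"

text \<open>The inverse Cartan matrix, that is, the Gram matrix of the fundamental weights of
  E8.\<close>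

definition E8_inverse_rows :: "int list list" where
  "E8_inverse_rows =
    [[4, 5, 7, 10, 8, 6, 4, 2],
     [5, 8, 10, 15, 12, 9, 6, 3],
     [7, 10, 14, 20, 16, 12, 8, 4],
     [10, 15, 20, 30, 24, 18, 12, 6],
     [8, 12, 16, 24, 20, 15, 10, 5],
     [6, 9, 12, 18, 15, 12, 8, 4],
     [4, 6, 8, 12, 10, 8, 6, 3],
     [2, 3, 4, 6, 5, 4, 3, 2]]"

lemma E8_rows_symmetric: "\<forall>i\<in>set [0..<8]. \<forall>j\<in>set [0..<8]. E8_rows ! i ! j = E8_rows ! j ! i"
  by code_simp

lemma E8_rows_inverse:
  "\<forall>i\<in>set [0..<8]. \<forall>j\<in>set [0..<8].
    sum_list (map (\<lambda>k. E8_rows ! i ! k * E8_inverse_rows ! k ! j) [0..<8]) = (if i = j then 1 else 0)"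
  by code_simp

lemma E8_gram_eq: "E8_gram = mat 8 8 (\<lambda>(i, j). E8_rows ! i ! j)"
  by (intro eq_matI) (simp_all add: E8_gram_def E8_rows_def mat_of_rows_list_def)

lemma unimodular_uminus_E8_gram: "unimodular_gram (- E8_gram)"
proof (rule unimodular_gramI[of _ 8 "- mat 8 8 (\<lambda>(i, j). E8_inverse_rows ! i ! j)"])
  let ?I = "mat 8 8 (\<lambda>(i, j). E8_inverse_rows ! i ! j)"
  show "transpose_mat (- E8_gram) = - E8_gram"
    using E8_rows_symmetric by (intro eq_matI) (auto simp: E8_gram_eq)
  have "E8_gram * ?I = 1\<^sub>m 8"
  proof (rule eq_matI)
    fix i j :: nat assume "i < dim_row (1\<^sub>m 8 :: int mat)" "j < dim_col (1\<^sub>m 8 :: int mat)"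
    then have ij: "i < 8" "j < 8" by auto
    then have "(E8_gram * ?I) $$ (i, j) = (\<Sum>k = 0..<8. E8_rows ! i ! k * E8_inverse_rows ! k ! j)"
      by (simp add: E8_gram_eq scalar_prod_def)
    also have "\<dots> = sum_list (map (\<lambda>k. E8_rows ! i ! k * E8_inverse_rows ! k ! j) [0..<8])"
      by (simp add: interv_sum_list_conv_sum_set_nat)
    also have "\<dots> = (if i = j then 1 else 0)" using E8_rows_inverse ij by (metis atLeastLessThan_iff set_upt zero_le)
    finally show "(E8_gram * ?I) $$ (i, j) = 1\<^sub>m 8 $$ (i, j)" using ij by simp
  qed (simp_all add: E8_gram_eq)
  then show "- E8_gram * - ?I = 1\<^sub>m 8"
    by (simp add: E8_gram_eq)
qed (simp_all add: E8_gram_eq)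

lemma unimodular_UE8_gram: "unimodular_gram (UE8_gram d)"
  unfolding UE8_gram_def
  by (rule unimodular_diag_block_mat)
     (auto simp: unimodular_hyperbolic_gram unimodular_uminus_E8_gram)

section \<open>The reduction of the lattice modulo \<open>l\<close>\<close>

theorem theorem4p4:
  fixes l d n :: nat and Q :: "'k::{field,finite} vec \<Rightarrow> 'k"
  assumes "Factorial_Ring.prime l" and "l > 2" and "CARD('k) = l" and "d \<ge> 1"
    and "n = 12 * d - 4" and "Q = reduced_form (UE8_gram d)"
  shows "fix_gen_poly n (coset_B n Q) = fix_gen_poly n (coset_C n Q) \<and>
    fix_gen_poly n (coset_Omega n Q) = fix_gen_poly n (coset_A n Q) +
      Polynomial.smult (1 / of_nat (card (coset_Omega n Q)))
        (\<Prod>i = 0..6 * d - 3. Polynomial.monom 1 2 - [:of_nat l ^ (2 * i):])"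
proof -
  let ?M = "map_mat of_int (UE8_gram d) :: 'k mat"
  have gram: "transpose_mat (UE8_gram d) = UE8_gram d" "is_unit (det (UE8_gram d))"
    using unimodular_UE8_gram by (auto simp: unimodular_gram_def)
  interpret S: quadratic_space n ?M
  proof
    show "?M \<in> carrier_mat n n" using UE8_gram_carrier[OF assms(4)] assms(5) by simp
    have "transpose_mat ?M = map_mat of_int (transpose_mat (UE8_gram d))"
      by (intro eq_matI) auto
    then show "transpose_mat ?M = ?M" using gram(1) by simp
    \<comment> \<open>The determinant commutes with the reduction, and the integral units 1 and -1
      remain nonzero in the field.\<close>
    have "det (UE8_gram d) = 1 \<or> det (UE8_gram d) = -1" using gram(2) by auto
    then show "det ?M \<noteq> 0" by (auto simp: of_int_hom.hom_det)
    have "odd l" using assms(1,2) prime_odd_nat by auto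
    then show "(2 :: 'k) \<noteq> 0" using assms(3) by (intro two_neq_zero_if_odd_CARD) simp
  qed
  have "S.Q = Q"
    by (rule ext) (simp add: S.Q_def S.bil_def assms(6) reduced_form_def)
  \<comment> \<open>Half of the dimension is \<open>m = 6 * d - 2\<close>, so the inclusive upper
    end of the product is \<open>m - 1\<close>; \<open>d \<ge> 1\<close> keeps the truncated
    subtractions exact.\<close>
  moreover have "{0..6 * d - 3} = {..<6 * d - 2}" using assms(4) by auto
  moreover have "n = 2 * (6 * d - 2)" "6 * d - 2 \<ge> 1" using assms(4,5) by auto
  ultimately show ?thesis
    using S.fix_gen_poly_cosets[of "6 * d - 2"] assms(3) by simp
qed

end
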